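(* Let $A\in\mathbb{R}^{N\times N}$ have right eigenvector matrix $V=[V_N\;\,V_E]$, where $V_N$ consists of $n$ eigenvectors with associated diagonal eigenvalue matrix $\hat\Lambda$ and $V_E$ consists of the remaining eigenvectors. Let the actual snapshot matrix be $X=X_{ac}=V_N\alpha_N+V_E\,\delta\alpha\in\mathbb{R}^{N\times pM_1}$, and let $\tilde A=T_r'AT_r$ be the $n\times n$ reduced order matrix constructed from $X_{ac}$ by snapshot POD, with eigendecomposition $\tilde AP_r=P_r\Lambda_r$, and let $V_r=T_rP_r$. Assume that both $A$ and $\tilde A$ have distinct eigenvalues and that $\|\delta\alpha\|\le C\epsilon$, where $C$ is a constant and $\epsilon>0$ is sufficiently small. Then there are constants $k_1,k_2$, independent of $\epsilon$, such that (with eigenvalues suitably ordered and eigenvectors suitably scaled) $$\|\Lambda_r-\hat\Lambda\|\le k_1\epsilon,\qquad \|V_r-\hat V\|\le k_2\epsilon,$$ where $\hat\Lambda$ is the diagonal matrix of the actual eigenvalues of $A$ active in the snapshots and $\hat V=V_N$ is the matrix of the corresponding actual eigenvectors of $A$.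
   Context: A prime denotes transpose. The snapshots are the states, at sampling times $t_1,\dots,t_{M_1}$, of the $p$ trajectories of the stable system $x_k=Ax_{k-1}$ started from the columns $b_1,\dots,b_p$ of an input matrix $B$; they form the columns of the snapshot matrix. Ideally only the $n$ eigenvectors in $V_N$ contribute to the snapshots ($n\le pM_1$), i.e. the snapshot matrix would be $X_{id}=V_N\alpha_N$, of rank $n$, where $\alpha_N$ is the $n\times pM_1$ coefficient matrix; the actual snapshot matrix is $X_{ac}=X_{id}+V_E\,\delta\alpha$, with $\delta\alpha$ the coefficient matrix of the remaining eigenvectors. Snapshot POD: $T_r=XV_p\Sigma_p^{-1/2}$, where $\Sigma_p$ is the diagonal matrix of the first (largest) $n$ non-zero eigenvalues of $X'X$ (here $X=X_{ac}$) and the columns of $V_p$ are corresponding orthonormal eigenvectors. The norm is any fixed matrix norm. "$\epsilon$ sufficiently small" and "constants independent of $\epsilon$" mean: there exist $\epsilon_0,k_1,k_2>0$ depending only on $A,V,\alpha_N,C$ such that the conclusion holds whenever $0<\epsilon\le\epsilon_0$ and $\|\delta\alpha\|\le C\epsilon$. *)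

theory Defs
  imports "Jordan_Normal_Form.Spectral_Radius" "Jordan_Normal_Form.DL_Rank"
begin

abbreviation cmat :: "real mat \<Rightarrow> complex mat" where
  "cmat \<equiv> map_mat complex_of_real"

(* One norm on each space of r x c matrices; submultiplicativity is not required. *)
definition matrix_norm :: "(complex mat \<Rightarrow> real) \<Rightarrow> bool" where
  "matrix_norm \<nu> \<longleftrightarrow>
     (\<forall>r c. \<forall>M \<in> carrier_mat r c.
        0 \<le> \<nu> M \<and> (\<nu> M = 0 \<longleftrightarrow> M = 0\<^sub>m r c) \<and>
        (\<forall>a. \<nu> (a \<cdot>\<^sub>m M) = cmod a * \<nu> M) \<and>
        (\<forall>M' \<in> carrier_mat r c. \<nu> (M + M') \<le> \<nu> M + \<nu> M'))"

(* Discrete-time stability of x_k = M x_{k-1}. *)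
definition stable_mat :: "complex mat \<Rightarrow> bool" where
  "stable_mat M \<longleftrightarrow> (\<forall>z \<in> spectrum M. cmod z < 1)"

definition distinct_eigenvalues :: "complex mat \<Rightarrow> bool" where
  "distinct_eigenvalues M \<longleftrightarrow> card (spectrum M) = dim_row M"

definition eigendecomposition :: "complex mat \<Rightarrow> complex mat \<Rightarrow> complex mat \<Rightarrow> bool" where
  "eigendecomposition M P D \<longleftrightarrow>
     P \<in> carrier_mat (dim_row M) (dim_row M) \<and> D \<in> carrier_mat (dim_row M) (dim_row M) \<and>
     invertible_mat P \<and> diagonal_mat D \<and> M * P = P * D"

definition join_cols :: "'a mat \<Rightarrow> 'a mat \<Rightarrow> 'a mat" where
  "join_cols M M' = mat_of_cols (dim_row M) (cols M @ cols M')"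

(* The states A^t b at the times t in ts, trajectory by trajectory. *)
definition snapshot_matrix :: "real mat \<Rightarrow> real mat \<Rightarrow> nat list \<Rightarrow> real mat" where
  "snapshot_matrix A B ts =
     mat_of_cols (dim_row A) [(A ^\<^sub>m t) *\<^sub>v b. b \<leftarrow> cols B, t \<leftarrow> ts]"

(* T = X V_p S^(-1/2), with S the diagonal matrix of the first n entries of es, the
   decreasing list of the eigenvalues of X'X with multiplicity. This is a relation,
   since V_p is only determined up to the choice of orthonormal eigenvectors. *)
definition snapshot_POD :: "nat \<Rightarrow> real mat \<Rightarrow> real mat \<Rightarrow> bool" where
  "snapshot_POD n X T \<longleftrightarrow>
     (\<exists>es Vp.
        char_poly (X\<^sup>T * X) = (\<Prod>e \<leftarrow> es. [:- e, 1:]) \<and> sorted_wrt (\<ge>) es \<and>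
        n \<le> length es \<and> (\<forall>i<n. es ! i \<noteq> 0) \<and>
        Vp \<in> carrier_mat (dim_col X) n \<and> Vp\<^sup>T * Vp = 1\<^sub>m n \<and>
        (X\<^sup>T * X) * Vp = Vp * mat_diag n (\<lambda>i. es ! i) \<and>
        T = X * Vp * mat_diag n (\<lambda>i. (es ! i) powr (- 1 / 2)))"

end

theory Submission
  imports Defs "HOL-Analysis.Function_Topology"
begin

text \<open>The POD basis \<open>T\<close> has orthonormal columns, and \<open>T T'\<close> is the orthogonal projection onto the span of
the leading \<open>n\<close> left singular vectors of the snapshot matrix \<open>X\<close>. The argument has two independent
halves.

\<^emph>\<open>The POD space almost contains the active eigenvectors.\<close> The squared Frobenius norm of the residual
\<open>X - T T' X\<close> is the sum of the eigenvalues of \<open>X'X\<close> beyond the \<open>n\<close>-th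
(\<open>snapshot_POD_residual\<close>). Since \<open>X\<close> differs from the rank-\<open>n\<close> matrix \<open>V_N \<alpha>_N\<close> only by
\<open>\<Delta> = V_E \<delta>\<alpha>\<close>, those eigenvalues are \<open>O(\<parallel>\<Delta>\<parallel>\<^sup>2)\<close>: the span of the first \<open>n + 1\<close>
eigenvectors contains a nonzero \<open>w\<close> with \<open>\<alpha>_N w = 0\<close>, for which \<open>X w = \<Delta> w\<close>
(\<open>eigenvalue_beyond_rank_le\<close>). A right inverse of \<open>\<alpha>_N\<close> then turns the bound for the snapshots into
\<open>V_N - T T' V_N = O(\<epsilon>)\<close> (\<open>POD_captures_dominant_subspace\<close>). Orthonormal eigenvectors for all of
\<open>X'X\<close> come from the spectral theorem \<open>symmetric_orthogonal_diagonalization\<close>.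

\<^emph>\<open>Compression to such a space almost preserves the eigenpairs.\<close> Put \<open>W = T' V_N\<close>. From
\<open>T W = V_N + O(\<epsilon>)\<close> and the left inverse of \<open>V_N\<close>, the matrix \<open>W\<close> is invertible with bounded
inverse, and \<open>(T' A T) W = W \<Lambda> + O(\<epsilon>)\<close> for the diagonal eigenvalue matrix \<open>\<Lambda>\<close> of \<open>V_N\<close>. So the
reduced matrix is similar, through \<open>W\<close>, to \<open>\<Lambda> + O(\<epsilon>)\<close>. The entries of \<open>\<Lambda>\<close> are separated,
hence every eigenbasis of \<open>\<Lambda> + O(\<epsilon>)\<close> is, after permutation and scaling, \<open>O(\<epsilon>)\<close>-close to the
standard basis (\<open>perturbed_diagonal_eigenbasis\<close>); multiplying by \<open>T W\<close> carries this back to \<open>V_N\<close>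
(\<open>invariant_subspace_perturbation\<close>).

All estimates are made in the entrywise maximum norm; equivalence of norms on a finite-dimensional
space transfers them to the given norm.\<close>

section \<open>The entrywise maximum norm\<close>

definition max_norm :: "complex mat \<Rightarrow> real" where
  "max_norm M =
     Max (insert 0 ((\<lambda>(i, j). cmod (M $$ (i, j))) ` ({..<dim_row M} \<times> {..<dim_col M})))"

lemma max_norm_nonneg [simp]: "0 \<le> max_norm M"
  unfolding max_norm_def by (rule Max_ge) auto

lemma norm_entry_le_max_norm:
  assumes "i < dim_row M" "j < dim_col M"
  shows "cmod (M $$ (i, j)) \<le> max_norm M"
  unfolding max_norm_def using assms by (intro Max_ge) (auto intro!: rev_image_eqI)

lemma max_norm_leI:
  assumes "0 \<le> K"
    and "\<And>i j. i < dim_row M \<Longrightarrow> j < dim_col M \<Longrightarrow> cmod (M $$ (i, j)) \<le> K"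
  shows "max_norm M \<le> K"
  unfolding max_norm_def using assms by (subst Max_le_iff) auto

lemma max_norm_mult:
  assumes A: "A \<in> carrier_mat r k" and B: "B \<in> carrier_mat k c"
  shows "max_norm (A * B) \<le> k * max_norm A * max_norm B"
proof (rule max_norm_leI)
  fix i j assume ij: "i < dim_row (A * B)" "j < dim_col (A * B)"
  have "cmod ((A * B) $$ (i, j)) = cmod (\<Sum>l<k. A $$ (i, l) * B $$ (l, j))"
    using ij A B by (simp add: scalar_prod_def atLeast0LessThan)
  also have "\<dots> \<le> (\<Sum>l<k. max_norm A * max_norm B)"
    using ij A B
    by (intro sum_norm_le) (auto simp: norm_mult intro!: mult_mono norm_entry_le_max_norm)
  finally show "cmod ((A * B) $$ (i, j)) \<le> k * max_norm A * max_norm B"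
    by simp
qed simp

lemma max_norm_mult_mono:
  assumes A: "A \<in> carrier_mat r k" and B: "B \<in> carrier_mat k c"
    and "max_norm A \<le> a" "max_norm B \<le> b"
  shows "max_norm (A * B) \<le> k * a * b"
proof -
  have "max_norm (A * B) \<le> k * max_norm A * max_norm B"
    by (rule max_norm_mult[OF A B])
  also have "\<dots> \<le> k * a * b"
    using assms(3,4) order_trans[OF max_norm_nonneg assms(3)] by (intro mult_mono) auto
  finally show ?thesis .
qed

lemma max_norm_minus:
  assumes "A \<in> carrier_mat r c" "B \<in> carrier_mat r c"
  shows "max_norm (A - B) \<le> max_norm A + max_norm B"
  using assms
  by (intro max_norm_leI)
     (auto intro!: order_trans[OF norm_triangle_ineq4] add_mono norm_entry_le_max_norm)

lemma max_norm_uminus: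
  assumes "A \<in> carrier_mat r c"
  shows "max_norm (- A) \<le> max_norm A"
  using assms by (intro max_norm_leI) (auto intro!: norm_entry_le_max_norm)

lemma max_norm_add:
  assumes "A \<in> carrier_mat r c" "B \<in> carrier_mat r c"
  shows "max_norm (A + B) \<le> max_norm A + max_norm B"
  using assms
  by (intro max_norm_leI)
     (auto intro!: order_trans[OF norm_triangle_ineq] add_mono norm_entry_le_max_norm)

text \<open>Expand the matrix in the standard basis of matrix units and apply the triangle inequality.\<close>
lemma matrix_norm_le_max_norm:
  assumes \<nu>: "matrix_norm \<nu>"
  shows "\<exists>K>0. \<forall>M \<in> carrier_mat r c. \<nu> M \<le> K * max_norm M"
proof -
  \<comment> \<open>the matrix units, and the restriction of a matrix to a set of positions\<close>
  define U where "U = (\<lambda>(a, b). mat r c (\<lambda>ij. if ij = (a, b) then 1 else (0::complex)))"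
  define part where "part = (\<lambda>S M. mat r c (\<lambda>ij. if ij \<in> S then M $$ ij else (0::complex)))"
  have pc: "part S M \<in> carrier_mat r c" for S M by (simp add: part_def)
  have Uc: "U ij \<in> carrier_mat r c" for ij by (cases ij) (simp add: U_def)
  have tri: "\<nu> (P + Q) \<le> \<nu> P + \<nu> Q" if "P \<in> carrier_mat r c" "Q \<in> carrier_mat r c" for P Q
    using \<nu> that unfolding matrix_norm_def by blast
  have scal: "\<nu> (a \<cdot>\<^sub>m P) = cmod a * \<nu> P" if "P \<in> carrier_mat r c" for P a
    using \<nu> that unfolding matrix_norm_def by blast
  have zero: "\<nu> (0\<^sub>m r c) = 0"
    using \<nu> unfolding matrix_norm_def by (metis zero_carrier_mat)
  have nonneg: "0 \<le> \<nu> P" if "P \<in> carrier_mat r c" for P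
    using \<nu> that unfolding matrix_norm_def by blast
  have sumb: "\<nu> (part S M) \<le> (\<Sum>ij\<in>S. max_norm M * \<nu> (U ij))"
    if "finite S" "S \<subseteq> {..<r} \<times> {..<c}" and M: "M \<in> carrier_mat r c" for S M
    using that(1,2)
  proof (induction S)
    case empty
    have "part {} M = 0\<^sub>m r c" by (auto simp: part_def)
    then show ?case by (simp add: zero)
  next
    case (insert ab S)
    obtain a b where ab: "ab = (a, b)" by (cases ab)
    have "a < r" "b < c" using insert.prems ab by auto
    have "part (insert ab S) M = part S M + M $$ ab \<cdot>\<^sub>m U ab"
      using insert.hyps by (intro eq_matI) (auto simp: part_def U_def ab)
    then have "\<nu> (part (insert ab S) M) \<le> \<nu> (part S M) + cmod (M $$ ab) * \<nu> (U ab)"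
      using tri[OF pc smult_carrier_mat[OF Uc]] scal[OF Uc] by simp
    also have "\<dots> \<le> (\<Sum>ij\<in>S. max_norm M * \<nu> (U ij)) + max_norm M * \<nu> (U ab)"
      using insert.IH insert.prems M \<open>a < r\<close> \<open>b < c\<close> nonneg[OF Uc]
      by (intro add_mono mult_right_mono) (auto simp: ab intro!: norm_entry_le_max_norm)
    finally show ?case using insert.hyps by simp
  qed
  let ?I = "{..<r} \<times> {..<c}"
  let ?K = "1 + (\<Sum>ij\<in>?I. \<nu> (U ij))"
  have K0: "(\<Sum>ij\<in>?I. \<nu> (U ij)) \<ge> 0" by (intro sum_nonneg nonneg Uc)
  have "\<nu> M \<le> ?K * max_norm M" if M: "M \<in> carrier_mat r c" for M
  proof -
    have "part ?I M = M" using M by (intro eq_matI) (auto simp: part_def)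
    then have "\<nu> M \<le> (\<Sum>ij\<in>?I. max_norm M * \<nu> (U ij))" using sumb[of ?I M] M by simp
    also have "\<dots> = max_norm M * (\<Sum>ij\<in>?I. \<nu> (U ij))" by (simp add: sum_distrib_left)
    also have "\<dots> \<le> ?K * max_norm M" by (simp add: algebra_simps)
    finally show ?thesis .
  qed
  then show ?thesis using K0 by (intro exI[of _ ?K]) auto
qed

text \<open>The nontrivial half of the equivalence of norms. A norm is continuous and positive on the unit sphere
of \<open>max_norm\<close>, which is compact, so it has a positive minimum there. Matrices are represented by
functions on index pairs, for which Tychonoff's theorem supplies the compactness.\<close>
lemma max_norm_le_matrix_norm:
  assumes \<nu>: "matrix_norm \<nu>"
  shows "\<exists>K>0. \<forall>M \<in> carrier_mat r c. max_norm M \<le> K * \<nu> M"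
proof -
  let ?I = "{..<r} \<times> {..<c}"
  let ?f = "\<lambda>\<phi>. \<nu> (mat r c \<phi>)"
  obtain K where K: "K > 0" "\<And>M. M \<in> carrier_mat r c \<Longrightarrow> \<nu> M \<le> K * max_norm M"
    using matrix_norm_le_max_norm[OF \<nu>] by blast
  have tri: "\<nu> (P + Q) \<le> \<nu> P + \<nu> Q" if "P \<in> carrier_mat r c" "Q \<in> carrier_mat r c" for P Q
    using \<nu> that unfolding matrix_norm_def by blast
  have scal: "\<nu> (a \<cdot>\<^sub>m P) = cmod a * \<nu> P" if "P \<in> carrier_mat r c" for P a
    using \<nu> that unfolding matrix_norm_def by blast
  have nz: "\<nu> P = 0 \<longleftrightarrow> P = 0\<^sub>m r c" if "P \<in> carrier_mat r c" for P
    using \<nu> that unfolding matrix_norm_def by blast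
  have nonneg: "0 \<le> \<nu> P" if "P \<in> carrier_mat r c" for P
    using \<nu> that unfolding matrix_norm_def by blast
  have step: "?f \<phi> - ?f \<psi> \<le> K * (\<Sum>ij\<in>?I. cmod (\<phi> ij - \<psi> ij))" for \<phi> \<psi>
  proof -
    have "mat r c \<phi> = mat r c \<psi> + mat r c (\<lambda>ij. \<phi> ij - \<psi> ij)" by (intro eq_matI) auto
    then have "?f \<phi> \<le> ?f \<psi> + \<nu> (mat r c (\<lambda>ij. \<phi> ij - \<psi> ij))"
      using tri by (metis mat_carrier)
    also have "\<nu> (mat r c (\<lambda>ij. \<phi> ij - \<psi> ij)) \<le> K * max_norm (mat r c (\<lambda>ij. \<phi> ij - \<psi> ij))"
      by (rule K(2)) simp
    also have "max_norm (mat r c (\<lambda>ij. \<phi> ij - \<psi> ij)) \<le> (\<Sum>ij\<in>?I. cmod (\<phi> ij - \<psi> ij))"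
      by (intro max_norm_leI sum_nonneg)
         (auto intro!: member_le_sum[of _ ?I "\<lambda>ij. cmod (\<phi> ij - \<psi> ij)"])
    finally show ?thesis using K(1) by simp
  qed
  have coord: "continuous_on UNIV (\<lambda>\<phi>::nat \<times> nat \<Rightarrow> complex. \<phi> ij)" for ij
    by (rule continuous_on_product_coordinates)
  have cont: "continuous_on UNIV ?f"
    unfolding continuous_on_def
  proof (intro ballI)
    fix \<psi> :: "nat \<times> nat \<Rightarrow> complex"
    have "((\<lambda>\<phi>. K * (\<Sum>ij\<in>?I. cmod (\<phi> ij - \<psi> ij))) \<longlongrightarrow> K * (\<Sum>ij\<in>?I. cmod (\<psi> ij - \<psi> ij)))
      (at \<psi>)"
      using coord unfolding continuous_on_def by (intro tendsto_intros) auto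
    then have lim: "((\<lambda>\<phi>. K * (\<Sum>ij\<in>?I. cmod (\<phi> ij - \<psi> ij))) \<longlongrightarrow> 0) (at \<psi>)" by simp
    have "((\<lambda>\<phi>. ?f \<phi> - ?f \<psi>) \<longlongrightarrow> 0) (at \<psi>)"
    proof (rule tendsto_0_le[OF lim, of _ 1], intro always_eventually allI)
      fix \<phi>
      have "0 \<le> K * (\<Sum>ij\<in>?I. cmod (\<phi> ij - \<psi> ij))"
        using K(1) by (intro mult_nonneg_nonneg sum_nonneg) auto
      then show "norm (?f \<phi> - ?f \<psi>) \<le> norm (K * (\<Sum>ij\<in>?I. cmod (\<phi> ij - \<psi> ij))) * 1"
        using step[of \<phi> \<psi>] step[of \<psi> \<phi>] by (simp add: norm_minus_commute)
    qed
    then show "(?f \<longlongrightarrow> ?f \<psi>) (at \<psi> within UNIV)" by (simp add: LIM_zero_iff)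
  qed
  let ?Q = "(\<lambda>(x, y). Complex x y) ` ({-1..1} \<times> {-1..1})"
  have "continuous_on ({-1..1} \<times> {-1..1}) (\<lambda>(x, y). Complex x y)"
    unfolding complex_eq case_prod_beta by (intro continuous_intros)
  then have Q: "compact ?Q" by (intro compact_continuous_image compact_Times compact_Icc)
  have unit_in_Q: "z \<in> ?Q" if "cmod z \<le> 1" for z
    using that abs_Re_le_cmod[of z] abs_Im_le_cmod[of z]
    by (intro rev_image_eqI[of "(Re z, Im z)"]) auto
  let ?B = "PiE UNIV (\<lambda>_. ?Q) :: (nat \<times> nat \<Rightarrow> complex) set"
  have "compactin (product_topology (\<lambda>_. euclidean) UNIV) ?B"
    unfolding compactin_PiE using Q by simp
  then have B: "compact ?B" by (simp add: euclidean_product_topology)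
  \<comment> \<open>the unit sphere of \<open>max_norm\<close>: modulus 1 is attained at some position of the matrix\<close>
  define S where "S = ?B \<inter> (\<Union>ij\<in>?I. {\<phi>. cmod (\<phi> ij) = 1})"
  have "closed (\<Union>ij\<in>?I. {\<phi>::nat \<times> nat \<Rightarrow> complex. cmod (\<phi> ij) = 1})"
    using coord by (intro closed_UN closed_Collect_eq ballI continuous_intros) auto
  then have "compact S" unfolding S_def using B by (rule compact_Int_closed[rotated])
  have "\<exists>m>0. \<forall>\<phi>\<in>S. m \<le> ?f \<phi>"
  proof (cases "S = {}")
    case True
    then show ?thesis by (intro exI[of _ 1]) auto
  next
    case False
    then obtain \<psi> where \<psi>: "\<psi> \<in> S" "\<And>\<phi>. \<phi> \<in> S \<Longrightarrow> ?f \<psi> \<le> ?f \<phi>"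
      using continuous_attains_inf[OF \<open>compact S\<close> False, of ?f] cont
      by (metis continuous_on_subset subset_UNIV)
    from \<psi>(1) obtain i j where "i < r" "j < c" "cmod (\<psi> (i, j)) = 1"
      unfolding S_def by auto
    then have "mat r c \<psi> $$ (i, j) \<noteq> 0" by auto
    then have "mat r c \<psi> \<noteq> 0\<^sub>m r c" using \<open>i < r\<close> \<open>j < c\<close> by (metis index_zero_mat(1))
    then have "?f \<psi> > 0" using nz[of "mat r c \<psi>"] nonneg[of "mat r c \<psi>"] by auto
    then show ?thesis using \<psi>(2) by blast
  qed
  then obtain m where m: "m > 0" "\<And>\<phi>. \<phi> \<in> S \<Longrightarrow> m \<le> ?f \<phi>" by blast
  have "max_norm M \<le> inverse m * \<nu> M" if M: "M \<in> carrier_mat r c" for M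
  proof (cases "max_norm M = 0")
    case True
    then show ?thesis using nonneg[OF M] m(1) by simp
  next
    case False
    let ?x = "max_norm M"
    have x: "?x > 0" using False max_norm_nonneg[of M] by linarith
    have "?x \<in> insert 0 ((\<lambda>(i, j). cmod (M $$ (i, j))) ` ({..<dim_row M} \<times> {..<dim_col M}))"
      unfolding max_norm_def by (rule Max_in) auto
    then obtain i j where ij: "i < r" "j < c" "cmod (M $$ (i, j)) = ?x"
      using False M by auto
    define \<phi> where "\<phi> = (\<lambda>ij. if ij \<in> ?I then M $$ ij / of_real ?x else 0)"
    have "\<phi> \<in> S"
      unfolding S_def
    proof (intro IntI)
      show "\<phi> \<in> ?B"
        using x M by (auto intro!: unit_in_Q simp: \<phi>_def norm_divide norm_entry_le_max_norm)
      show "\<phi> \<in> (\<Union>ij\<in>?I. {\<phi>. cmod (\<phi> ij) = 1})"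
        using ij x by (intro UN_I[of "(i, j)"]) (auto simp: \<phi>_def norm_divide)
    qed
    then have "m \<le> ?f \<phi>" by (rule m(2))
    moreover have "mat r c \<phi> = (1 / of_real ?x) \<cdot>\<^sub>m M"
      using M by (intro eq_matI) (auto simp: \<phi>_def)
    ultimately have "m \<le> \<nu> M / ?x" using scal[OF M] x by (simp add: norm_divide)
    then show ?thesis using x m(1) by (simp add: field_simps)
  qed
  then show ?thesis using m(1) by (intro exI[of _ "inverse m"]) auto
qed

section \<open>Entries, inverses and full rank\<close>

lemma mult_mat_entry:
  assumes "A \<in> carrier_mat r n" "B \<in> carrier_mat n c" "i < r" "j < c"
  shows "(A * B) $$ (i, j) = (\<Sum>k<n. A $$ (i, k) * B $$ (k, j))"
  using assms by (simp add: scalar_prod_def atLeast0LessThan)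

lemma gram_entry:
  assumes "B \<in> carrier_mat N m" "i < m" "j < m"
  shows "(B\<^sup>T * B) $$ (i, j) = (\<Sum>k<N. B $$ (k, i) * B $$ (k, j))"
  using assms by (simp add: scalar_prod_def atLeast0LessThan)

lemma mult_mat_vec_entry:
  assumes "M \<in> carrier_mat N m" "i < N"
  shows "(M *\<^sub>v vec m d) $ i = (\<Sum>k<m. M $$ (i, k) * d k)"
  using assms by (simp add: scalar_prod_def atLeast0LessThan)

lemma cmat_mult3:
  assumes "A \<in> carrier_mat r k" "B \<in> carrier_mat k l" "C \<in> carrier_mat l c"
  shows "cmat (A * B * C) = cmat A * cmat B * cmat C"
  by (simp only: of_real_hom.mat_hom_mult[OF mult_carrier_mat[OF assms(1,2)] assms(3)]
      of_real_hom.mat_hom_mult[OF assms(1,2)])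

lemma finite_argmax:
  fixes h :: "nat \<Rightarrow> real"
  assumes "0 < n"
  obtains i where "i < n" "\<And>k. k < n \<Longrightarrow> h k \<le> h i"
proof -
  have "Max (h ` {..<n}) \<in> h ` {..<n}" using assms by (intro Max_in) auto
  then obtain i where i: "i < n" "h i = Max (h ` {..<n})" by auto
  have "h k \<le> h i" if "k < n" for k
    unfolding i(2) using that by (intro Max_ge) auto
  then show ?thesis using i(1) that by blast
qed

lemma inverse_of_det_nonzero:
  fixes M :: "'a :: field mat"
  assumes M: "M \<in> carrier_mat n n" and det: "det M \<noteq> 0"
  obtains Q where "Q \<in> carrier_mat n n" "M * Q = 1\<^sub>m n" "Q * M = 1\<^sub>m n"
  using det_non_zero_imp_unit[OF M det, of "()"] that
  by (auto simp: Units_def ring_mat_def)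

lemma invertible_mat_inverse:
  assumes M: "M \<in> carrier_mat n n" and inv: "invertible_mat M"
  obtains B where "B \<in> carrier_mat n n" "M * B = 1\<^sub>m n" "B * M = 1\<^sub>m n"
proof -
  obtain B where B: "M * B = 1\<^sub>m n" "B * M = 1\<^sub>m (dim_row B)"
    using inv M by (auto simp: invertible_mat_def inverts_mat_def)
  have "dim_col B = n" using arg_cong[OF B(1), of dim_col] by simp
  moreover have "dim_row B = n" using arg_cong[OF B(2), of dim_col] M by simp
  ultimately show ?thesis using that[of B] B by auto
qed

text \<open>Choose \<open>n\<close> linearly independent columns of \<open>Y \<alpha>\<close>. The corresponding \<open>n\<close> columns of \<open>\<alpha>\<close> form a
square matrix whose kernel is mapped by \<open>Y\<close> to relations among the chosen columns; so it is
invertible, and padding its inverse with zero rows gives the right inverse.\<close>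
lemma full_rank_product_right_inverse:
  fixes Y \<alpha> :: "complex mat"
  assumes Y: "Y \<in> carrier_mat N n" and \<alpha>: "\<alpha> \<in> carrier_mat n m"
    and rank: "vec_space.rank N (Y * \<alpha>) = n"
  obtains R where "R \<in> carrier_mat m n" "\<alpha> * R = 1\<^sub>m n"
proof -
  interpret vec_space "TYPE(complex)" N .
  have Y\<alpha>: "Y * \<alpha> \<in> carrier_mat N m" using Y \<alpha> by simp
  obtain S where S: "maximal S (\<lambda>T. T \<subseteq> set (cols (Y * \<alpha>)) \<and> lin_indpt T)"
    using maximal_exists_superset[of "set (cols (Y * \<alpha>))"
        "\<lambda>T. T \<subseteq> set (cols (Y * \<alpha>)) \<and> lin_indpt T" "{}"]
    by (auto simp: finite_lin_indpt2)
  then have cardS: "card S = n" using rank_card_indpt[OF Y\<alpha> S] rank by simp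
  from S have Sc: "S \<subseteq> set (cols (Y * \<alpha>))" and ind: "lin_indpt S" by (auto simp: maximal_def)
  obtain ss where ss: "set ss = S" "distinct ss"
    using finite_distinct_list[of S] Sc finite_subset by blast
  have len: "length ss = n" using ss cardS distinct_card by fastforce
  have "\<exists>j<m. ss ! k = col (Y * \<alpha>) j" if "k < n" for k
  proof -
    have "ss ! k \<in> set (cols (Y * \<alpha>))" using that len ss(1) Sc by (metis nth_mem subsetD)
    then show ?thesis using \<alpha> by (auto simp: cols_def)
  qed
  then obtain J where J: "\<And>k. k < n \<Longrightarrow> J k < m" "\<And>k. k < n \<Longrightarrow> ss ! k = col (Y * \<alpha>) (J k)"
    by metis
  have ssc: "set ss \<subseteq> carrier_vec N" using ss(1) Sc Y cols_dim[of "Y * \<alpha>"] by auto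
  define Sel where "Sel = mat m n (\<lambda>(i, k). if i = J k then 1 else (0 :: complex))"
  have Sel: "Sel \<in> carrier_mat m n" by (simp add: Sel_def)
  define M where "M = \<alpha> * Sel"
  have M: "M \<in> carrier_mat n n" using \<alpha> Sel by (simp add: M_def)
  have Mcol: "col M k = col \<alpha> (J k)" if k: "k < n" for k
  proof (rule eq_vecI)
    fix i assume "i < dim_vec (col \<alpha> (J k))"
    then have i: "i < n" using \<alpha> by simp
    have "col M k $ i = (\<Sum>j<m. \<alpha> $$ (i, j) * (if j = J k then 1 else 0))"
      using i k \<alpha> Sel by (simp add: M_def Sel_def scalar_prod_def atLeast0LessThan)
    also have "\<dots> = \<alpha> $$ (i, J k)" using J(1)[OF k] by (simp add: if_distrib cong: if_cong)
    finally show "col M k $ i = col \<alpha> (J k) $ i" using i J(1)[OF k] \<alpha> by simp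
  qed (use \<alpha> M in simp)
  have YM: "Y * M = mat_of_cols N ss"
  proof (rule mat_col_eqI)
    fix k assume "k < dim_col (mat_of_cols N ss)"
    then have k: "k < n" using len by simp
    have "col (Y * M) k = Y *\<^sub>v col M k" by (rule col_mult2[OF Y M k])
    also have "\<dots> = ss ! k" unfolding Mcol[OF k] J(2)[OF k] col_mult2[OF Y \<alpha> J(1)[OF k]] ..
    finally show "col (Y * M) k = col (mat_of_cols N ss) k"
      using k len ssc by (simp add: subset_code(1))
  qed (use Y M len in auto)
  have "det M \<noteq> 0"
  proof
    assume "det M = 0"
    then obtain v where v: "v \<in> carrier_vec n" "v \<noteq> 0\<^sub>v n" "M *\<^sub>v v = 0\<^sub>v n"
      using det_0_iff_vec_prod_zero[OF M] by blast
    have "mat_of_cols N ss *\<^sub>v v = Y *\<^sub>v (M *\<^sub>v v)"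
      unfolding YM[symmetric] using Y M v(1) by simp
    also have "\<dots> = 0\<^sub>v N" unfolding v(3) using Y by (intro eq_vecI) auto
    finally have "lin_dep (set (cols (mat_of_cols N ss)))"
      using v len ss(2) ssc by (intro lin_depI[of _ n v]) auto
    then show False using ind ss(1) ssc by simp
  qed
  then obtain Q where Q: "Q \<in> carrier_mat n n" "M * Q = 1\<^sub>m n"
    using inverse_of_det_nonzero[OF M] by blast
  show ?thesis
  proof (rule that[of "Sel * Q"])
    show "Sel * Q \<in> carrier_mat m n" using Sel Q by simp
    show "\<alpha> * (Sel * Q) = 1\<^sub>m n"
      using assoc_mult_mat[OF \<alpha> Sel Q(1)] Q(2) by (simp add: M_def)
  qed
qed

lemma max_norm_one_mat: "max_norm (1\<^sub>m n) \<le> 1"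
  by (intro max_norm_leI) auto

text \<open>If \<open>v = B v\<close>, the largest entry of \<open>v\<close> is at most half of itself, so \<open>1 - B\<close> is injective. The
same comparison applied to \<open>Z = 1 + B Z\<close> bounds the inverse.\<close>
lemma near_identity_inverse:
  assumes B: "B \<in> carrier_mat n n" and small: "n * max_norm B \<le> 1 / 2"
  obtains Z where "Z \<in> carrier_mat n n" "Z * (1\<^sub>m n - B) = 1\<^sub>m n" "max_norm Z \<le> 2"
proof -
  have IB: "1\<^sub>m n - B \<in> carrier_mat n n" using B by (simp add: minus_carrier_mat)
  have "det (1\<^sub>m n - B) \<noteq> 0"
  proof
    assume "det (1\<^sub>m n - B) = 0"
    then obtain v where v: "v \<in> carrier_vec n" "v \<noteq> 0\<^sub>v n" "(1\<^sub>m n - B) *\<^sub>v v = 0\<^sub>v n"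
      using det_0_iff_vec_prod_zero[OF IB] by blast
    have vB: "v $ i = (\<Sum>k<n. B $$ (i, k) * v $ k)" if i: "i < n" for i
    proof -
      have "(1\<^sub>m n - B) *\<^sub>v v = 1\<^sub>m n *\<^sub>v v - B *\<^sub>v v"
        by (rule minus_mult_distrib_mat_vec[of _ n n]) (use B v in auto)
      then have "v $ i - (B *\<^sub>v v) $ i = 0"
        using arg_cong[OF v(3), of "\<lambda>w. w $ i"] v(1) B i by simp
      then show ?thesis using v(1) B i by (simp add: scalar_prod_def atLeast0LessThan)
    qed
    have "n > 0" using v(1,2) by (cases n) auto
    then obtain i where i: "i < n" "\<And>k. k < n \<Longrightarrow> cmod (v $ k) \<le> cmod (v $ i)"
      using finite_argmax[of n "\<lambda>k. cmod (v $ k)"] by blast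
    have "cmod (v $ i) \<le> (\<Sum>k<n. max_norm B * cmod (v $ i))"
      unfolding vB[OF i(1)] using i B
      by (intro sum_norm_le)
        (auto simp: norm_mult vB[OF i(1), symmetric] intro!: mult_mono norm_entry_le_max_norm)
    also have "\<dots> = (n * max_norm B) * cmod (v $ i)" by simp
    also have "\<dots> \<le> 1 / 2 * cmod (v $ i)" using small by (intro mult_right_mono) auto
    finally have "v $ i = 0" by simp
    then have "v = 0\<^sub>v n" using i(2) v(1) by (intro eq_vecI) auto
    then show False using v(2) by simp
  qed
  then obtain Z where Z: "Z \<in> carrier_mat n n" "(1\<^sub>m n - B) * Z = 1\<^sub>m n" "Z * (1\<^sub>m n - B) = 1\<^sub>m n"
    using inverse_of_det_nonzero[OF IB] by blast
  have "(1\<^sub>m n - B) * Z = 1\<^sub>m n * Z - B * Z"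
    by (rule minus_mult_distrib_mat[of _ n n _ _ n]) (use B Z in auto)
  then have "Z - B * Z = 1\<^sub>m n" using Z by simp
  then have "Z = 1\<^sub>m n + B * Z"
  proof -
    have "Z $$ (i, j) = (1\<^sub>m n + B * Z) $$ (i, j)" if "i < n" "j < n" for i j
      using arg_cong[OF \<open>Z - B * Z = 1\<^sub>m n\<close>, of "\<lambda>M. M $$ (i, j)"] that Z(1) B
      by (simp add: algebra_simps del: index_mult_mat(1) index_one_mat(1))
    then show ?thesis using Z(1) B by (intro eq_matI) auto
  qed
  then have "max_norm Z \<le> max_norm (1\<^sub>m n) + max_norm (B * Z)"
    using max_norm_add[of "1\<^sub>m n" n n "B * Z"] B Z by simp
  also have "max_norm (B * Z) \<le> (n * max_norm B) * max_norm Z" by (rule max_norm_mult[OF B Z(1)])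
  also have "\<dots> \<le> 1 / 2 * max_norm Z" using small by (intro mult_right_mono) auto
  finally have "max_norm Z \<le> 2" using max_norm_one_mat[of n] by linarith
  then show ?thesis using that Z by blast
qed

section \<open>Eigenvectors of a perturbed diagonal matrix\<close>

text \<open>Scale each eigenvector so that its largest entry, at position \<open>f j\<close> say, is 1. Row \<open>f j\<close> of the
eigenvector equation places the eigenvalue within \<open>\<rho>\<close> of \<open>l (f j)\<close>, as in Gershgorin's theorem, and
the other rows force all other entries to be small, because the other \<open>l i\<close> are far away. What
remains is that \<open>f\<close> is injective: if two eigenvectors shared the position of their largest entry,
their difference \<open>u\<close> would vanish there; row \<open>f j\<close> would make the two eigenvalues differ by at most
\<open>\<rho> \<parallel>u\<parallel>\<close>, and the row of the largest entry of \<open>u\<close> would give \<open>(d - \<rho>) \<parallel>u\<parallel> \<le> 2 \<rho> \<parallel>u\<parallel>\<close>, so that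
\<open>u = 0\<close> and the eigenvectors would be dependent. Thus \<open>f\<close> is a bijection and its inverse is the
required ordering.\<close>
lemma perturbed_diagonal_eigenbasis:
  fixes l :: "nat \<Rightarrow> complex" and G Y D :: "complex mat"
  assumes G: "G \<in> carrier_mat n n" and Y: "Y \<in> carrier_mat n n"
    and D: "D \<in> carrier_mat n n" "diagonal_mat D"
    and inv: "det Y \<noteq> 0"
    and eq: "(mat_diag n l + G) * Y = Y * D"
    and sep: "\<And>i j. i < n \<Longrightarrow> j < n \<Longrightarrow> i \<noteq> j \<Longrightarrow> d \<le> cmod (l i - l j)"
    and small: "\<And>i. i < n \<Longrightarrow> (\<Sum>k<n. cmod (G $$ (i, k))) \<le> \<rho>"
    and \<rho>: "0 \<le> \<rho>" "4 * \<rho> < d"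
  shows "\<exists>\<pi> c. \<pi> permutes {..<n} \<and>
    (\<forall>j<n. c j \<noteq> 0 \<and> cmod (D $$ (\<pi> j, \<pi> j) - l j) \<le> \<rho> \<and>
      (\<forall>i<n. cmod (c j * Y $$ (i, \<pi> j) - (if i = j then 1 else 0)) \<le> 2 * \<rho> / d))"
proof -
  define \<mu> where "\<mu> j = D $$ (j, j)" for j
  have d: "d > 0" using \<rho> by linarith
  have ev: "l i * Y $$ (i, j) + (\<Sum>k<n. G $$ (i, k) * Y $$ (k, j)) = \<mu> j * Y $$ (i, j)"
    if ij: "i < n" "j < n" for i j
  proof -
    have "((mat_diag n l + G) * Y) $$ (i, j) = (mat_diag n l * Y + G * Y) $$ (i, j)"
      using G Y by (subst add_mult_distrib_mat[of _ n n]) auto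
    also have "\<dots> = l i * Y $$ (i, j) + (\<Sum>k<n. G $$ (i, k) * Y $$ (k, j))"
      using G Y ij by (simp add: mat_diag_mult_left[OF Y] scalar_prod_def atLeast0LessThan)
    finally have 1: "((mat_diag n l + G) * Y) $$ (i, j) = \<dots>" .
    have "(Y * D) $$ (i, j) = (\<Sum>k<n. Y $$ (i, k) * D $$ (k, j))"
      using Y D ij by (simp add: scalar_prod_def atLeast0LessThan)
    also have "\<dots> = (\<Sum>k\<in>{j}. Y $$ (i, k) * D $$ (k, j))"
      using D ij by (intro sum.mono_neutral_right) (auto simp: diagonal_mat_def)
    finally show ?thesis using 1 eq by (simp add: \<mu>_def mult.commute)
  qed
  have row: "cmod (\<Sum>k<n. G $$ (i, k) * u k) \<le> \<rho> * m"
    if "i < n" "\<And>k. k < n \<Longrightarrow> cmod (u k) \<le> m" for i u m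
  proof -
    have "0 \<le> m" using that(2)[OF that(1)] norm_ge_zero order_trans by blast
    have "cmod (\<Sum>k<n. G $$ (i, k) * u k) \<le> (\<Sum>k<n. cmod (G $$ (i, k)) * m)"
      using that(2) by (intro sum_norm_le) (auto simp: norm_mult intro!: mult_left_mono)
    also have "\<dots> = (\<Sum>k<n. cmod (G $$ (i, k))) * m" by (simp add: sum_distrib_right)
    also have "\<dots> \<le> \<rho> * m" using small[OF that(1)] \<open>0 \<le> m\<close> by (rule mult_right_mono)
    finally show ?thesis .
  qed
  \<comment> \<open>the columns of \<open>Y\<close> satisfy no nontrivial linear relation\<close>
  have indep: "\<not> (\<forall>i<n. (\<Sum>k<n. Y $$ (i, k) * w k) = 0)" if "j < n" "w j \<noteq> 0" for w j
  proof
    assume *: "\<forall>i<n. (\<Sum>k<n. Y $$ (i, k) * w k) = 0"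
    have "Y *\<^sub>v vec n w = 0\<^sub>v n"
      using Y * by (intro eq_vecI) (auto simp: scalar_prod_def atLeast0LessThan)
    moreover have "vec n w \<noteq> 0\<^sub>v n" using that by (metis index_vec index_zero_vec(1))
    ultimately show False using inv det_0_iff_vec_prod_zero[OF Y] by (metis vec_carrier)
  qed
  have "\<exists>i<n. \<forall>k<n. cmod (Y $$ (k, j)) \<le> cmod (Y $$ (i, j))" if "j < n" for j
    using finite_argmax[of n "\<lambda>k. cmod (Y $$ (k, j))"] that by (metis not_less0 not_gr_zero)
  then obtain f where f: "\<And>j. j < n \<Longrightarrow> f j < n"
    "\<And>j k. j < n \<Longrightarrow> k < n \<Longrightarrow> cmod (Y $$ (k, j)) \<le> cmod (Y $$ (f j, j))"
    by metis
  have nz: "Y $$ (f j, j) \<noteq> 0" if j: "j < n" for j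
  proof
    assume "Y $$ (f j, j) = 0"
    then have z: "Y $$ (k, j) = 0" if "k < n" for k using f(2)[OF j that] by simp
    have "(\<Sum>k<n. Y $$ (i, k) * (if k = j then 1 else 0)) = 0" if "i < n" for i
      using z[OF that] by (simp add: if_distrib cong: if_cong)
    then show False using indep[OF j, of "\<lambda>k. if k = j then 1 else 0"] by simp
  qed
  define a where "a j k = Y $$ (k, j) / Y $$ (f j, j)" for j k
  have a1: "a j (f j) = 1" if "j < n" for j using nz[OF that] by (simp add: a_def)
  have ale: "cmod (a j k) \<le> 1" if "j < n" "k < n" for j k
    using f(2)[OF that] nz[OF that(1)] by (simp add: a_def norm_divide)
  have eva: "l i * a j i + (\<Sum>k<n. G $$ (i, k) * a j k) = \<mu> j * a j i"
    if "i < n" "j < n" for i j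
  proof -
    have "l i * a j i + (\<Sum>k<n. G $$ (i, k) * a j k) =
        (l i * Y $$ (i, j) + (\<Sum>k<n. G $$ (i, k) * Y $$ (k, j))) / Y $$ (f j, j)"
      by (simp add: a_def add_divide_distrib sum_divide_distrib)
    then show ?thesis using ev[OF that] by (simp add: a_def)
  qed
  have near: "cmod (\<mu> j - l (f j)) \<le> \<rho>" if j: "j < n" for j
  proof -
    have "\<mu> j - l (f j) = (\<Sum>k<n. G $$ (f j, k) * a j k)"
      using eva[OF f(1)[OF j] j] a1[OF j] by (simp add: algebra_simps)
    then show ?thesis using row[OF f(1)[OF j], of "a j" 1] ale[OF j] by simp
  qed
  have far: "d - \<rho> \<le> cmod (l i - \<mu> j)" if "i < n" "j < n" "i \<noteq> f j" for i j
  proof -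
    have "d \<le> cmod (l i - l (f j))" using sep that f(1) by blast
    also have "\<dots> \<le> cmod (l i - \<mu> j) + cmod (\<mu> j - l (f j))"
      using norm_triangle_ineq[of "l i - \<mu> j" "\<mu> j - l (f j)"] by simp
    finally show ?thesis using near[OF that(2)] by linarith
  qed
  have close: "cmod (a j i - (if i = f j then 1 else 0)) \<le> 2 * \<rho> / d" if "i < n" "j < n" for i j
  proof (cases "i = f j")
    case True
    then show ?thesis using a1[OF that(2)] \<rho> d by simp
  next
    case False
    have "(l i - \<mu> j) * a j i = - (\<Sum>k<n. G $$ (i, k) * a j k)"
      using eva[OF that] by (simp add: algebra_simps eq_neg_iff_add_eq_0)
    then have "cmod (l i - \<mu> j) * cmod (a j i) \<le> \<rho>"
      using row[OF that(1), of "a j" 1] ale[OF that(2)]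
      by (metis mult.right_neutral norm_minus_cancel norm_mult)
    moreover have "d / 2 * cmod (a j i) \<le> cmod (l i - \<mu> j) * cmod (a j i)"
      using far[OF that False] \<rho> by (intro mult_right_mono) auto
    ultimately have "d / 2 * cmod (a j i) \<le> \<rho>" by linarith
    then show ?thesis using False d by (simp add: field_simps)
  qed
  have inj: "inj_on f {..<n}"
  proof (rule inj_onI, rule ccontr)
    fix j j' assume j: "j \<in> {..<n}" and j': "j' \<in> {..<n}" and ff: "f j = f j'" and ne: "j \<noteq> j'"
    define u where "u k = a j k - a j' k" for k
    obtain k0 where k0: "k0 < n" "\<And>k. k < n \<Longrightarrow> cmod (u k) \<le> cmod (u k0)"
      using finite_argmax[of n "\<lambda>k. cmod (u k)"] j by auto
    \<comment> \<open>the coefficients that express the difference \<open>u\<close> through the columns of \<open>Y\<close>\<close>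
    let ?w = "\<lambda>k. (if k = j then 1 / Y $$ (f j, j) else 0) - (if k = j' then 1 / Y $$ (f j', j') else 0)"
    have uw: "(\<Sum>k<n. Y $$ (i, k) * ?w k) = u i" if "i < n" for i
    proof -
      have single: "(\<Sum>k<n. Y $$ (i, k) * (if k = q then x else 0)) = Y $$ (i, q) * x"
        if "q < n" for q x
        using that by (simp add: if_distrib cong: if_cong)
      show ?thesis
        using j j' by (simp add: right_diff_distrib sum_subtractf single u_def a_def)
    qed
    have "?w j \<noteq> 0" using nz[of j] j ne by simp
    then have "\<not> (\<forall>i<n. u i = 0)" using indep[of j ?w] j uw by auto
    then have m: "cmod (u k0) > 0" using k0(2) by fastforce
    have ui: "u (f j) = 0" using a1[of j] a1[of j'] j j' ff by (simp add: u_def)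
    then have "k0 \<noteq> f j" using m by auto
    have evu: "(l i - \<mu> j) * u i + (\<Sum>k<n. G $$ (i, k) * u k) = (\<mu> j - \<mu> j') * a j' i" if "i < n" for i
      using eva[OF that, of j] eva[OF that, of j'] j j'
      by (simp add: u_def algebra_simps sum_subtractf)
    have "\<mu> j - \<mu> j' = (\<Sum>k<n. G $$ (f j, k) * u k)"
      using evu[of "f j"] f(1)[of j] j j' ui a1[of j'] ff by simp
    then have \<mu>\<mu>: "cmod (\<mu> j - \<mu> j') \<le> \<rho> * cmod (u k0)"
      using row[of "f j" u] f(1)[of j] j k0(2) by simp
    have "(l k0 - \<mu> j) * u k0 = (\<mu> j - \<mu> j') * a j' k0 - (\<Sum>k<n. G $$ (k0, k) * u k)"
      using evu[OF k0(1)] by (simp add: algebra_simps)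
    then have "cmod (l k0 - \<mu> j) * cmod (u k0) \<le>
        cmod ((\<mu> j - \<mu> j') * a j' k0) + cmod (\<Sum>k<n. G $$ (k0, k) * u k)"
      by (metis norm_mult norm_triangle_ineq4)
    also have "\<dots> \<le> \<rho> * cmod (u k0) * 1 + \<rho> * cmod (u k0)"
      unfolding norm_mult using \<mu>\<mu> ale[of j' k0] j' k0 row[OF k0(1), of u] \<rho>
      by (intro add_mono mult_mono) auto
    finally have "cmod (l k0 - \<mu> j) * cmod (u k0) \<le> (2 * \<rho>) * cmod (u k0)" by simp
    then have "cmod (l k0 - \<mu> j) \<le> 2 * \<rho>" using m by simp
    moreover have "d - \<rho> \<le> cmod (l k0 - \<mu> j)" using far[of k0 j] k0 j \<open>k0 \<noteq> f j\<close> by simp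
    ultimately show False using \<rho> by linarith
  qed
  define F where "F j = (if j < n then f j else j)" for j
  have "F permutes {..<n}"
  proof (rule bij_imp_permutes)
    have "inj_on F {..<n}" using inj by (simp add: F_def inj_on_def)
    moreover have "F ` {..<n} \<subseteq> {..<n}" using f(1) by (auto simp: F_def)
    ultimately show "bij_betw F {..<n} {..<n}"
      by (simp add: bij_betw_def endo_inj_surj)
  qed (simp add: F_def)
  define \<pi> where "\<pi> = Hilbert_Choice.inv F"
  have \<pi>: "\<pi> permutes {..<n}" unfolding \<pi>_def using \<open>F permutes {..<n}\<close> by (rule permutes_inv)
  have \<pi>n: "\<pi> j < n" "f (\<pi> j) = j" if "j < n" for j
  proof -
    show "\<pi> j < n" using permutes_in_image[OF \<pi>, of j] that by simp
    then show "f (\<pi> j) = j"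
      using permutes_inverses(1)[OF \<open>F permutes {..<n}\<close>, of j] by (simp add: \<pi>_def F_def)
  qed
  show ?thesis
  proof (intro exI conjI allI impI)
    show "\<pi> permutes {..<n}" by (rule \<pi>)
    fix j assume j: "j < n"
    show "1 / Y $$ (j, \<pi> j) \<noteq> 0" using nz[OF \<pi>n(1)[OF j]] \<pi>n(2)[OF j] by simp
    show "cmod (D $$ (\<pi> j, \<pi> j) - l j) \<le> \<rho>"
      using near[OF \<pi>n(1)[OF j]] \<pi>n(2)[OF j] by (simp add: \<mu>_def)
    fix i assume i: "i < n"
    show "cmod (1 / Y $$ (j, \<pi> j) * Y $$ (i, \<pi> j) - (if i = j then 1 else 0)) \<le> 2 * \<rho> / d"
      using close[OF i \<pi>n(1)[OF j]] \<pi>n(2)[OF j] by (simp add: a_def)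
  qed
qed

section \<open>Compression to a nearly invariant subspace\<close>

text \<open>\<open>T\<close> spans the trial space, \<open>T'\<close> tests against it, and \<open>\<eta>\<close> measures how far the invariant subspace
spanned by \<open>V\<close> is from being reproduced by \<open>T T'\<close>. With \<open>W = T' V\<close> and \<open>E = V - T W\<close> one has
\<open>L T W = 1 - L E\<close>, so \<open>W\<close> has the inverse \<open>U = (1 - L E)\<^sup>-\<^sup>1 L T\<close>, bounded independently of \<open>T\<close>; and
\<open>(T' A T) W = W \<Lambda> - T' A E\<close>. Therefore \<open>U (T' A T) W\<close> is a small perturbation of \<open>\<Lambda>\<close> with the
eigenbasis \<open>U P\<close>, to which the previous lemma applies, and \<open>T P = (V - E) (U P)\<close> recovers the
eigenvectors in the full space.\<close>
lemma invariant_subspace_perturbation: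
  fixes A V L :: "complex mat" and l :: "nat \<Rightarrow> complex"
  assumes A: "A \<in> carrier_mat N N" and V: "V \<in> carrier_mat N n" and L: "L \<in> carrier_mat n N"
    and LV: "L * V = 1\<^sub>m n" and AV: "A * V = V * mat_diag n l" and l: "inj_on l {..<n}"
  shows "\<exists>\<eta>0>0. \<exists>K>0. \<forall>T T' P D \<eta>. T \<in> carrier_mat N n \<longrightarrow> T' \<in> carrier_mat n N \<longrightarrow>
      max_norm T \<le> 1 \<longrightarrow> max_norm T' \<le> 1 \<longrightarrow>
      max_norm (V - T * (T' * V)) \<le> \<eta> \<longrightarrow> \<eta> \<le> \<eta>0 \<longrightarrow>
      eigendecomposition (T' * A * T) P D \<longrightarrow>
      (\<exists>\<pi> c. \<pi> permutes {..<n} \<and> (\<forall>j<n. c j \<noteq> 0) \<and>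
        max_norm (mat n n (\<lambda>(i, j). D $$ (\<pi> i, \<pi> j)) - mat_diag n l) \<le> K * \<eta> \<and>
        max_norm (mat N n (\<lambda>(i, j). c j * (T * P) $$ (i, \<pi> j)) - V) \<le> K * \<eta>)"
proof -
  obtain d where d: "d > 0" "\<And>i j. i < n \<Longrightarrow> j < n \<Longrightarrow> i \<noteq> j \<Longrightarrow> d \<le> cmod (l i - l j)"
  proof -
    let ?D = "insert 1 ((\<lambda>(i, j). cmod (l i - l j)) ` {(i, j). i < n \<and> j < n \<and> i \<noteq> j})"
    have "{(i, j). i < n \<and> j < n \<and> i \<noteq> j} \<subseteq> {..<n} \<times> {..<n}" by auto
    then have fin: "finite ?D" using finite_subset by blast
    have "0 < Min ?D" using fin l by (subst Min_gr_iff) (auto simp: inj_on_def)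
    moreover have "Min ?D \<le> cmod (l i - l j)" if "i < n" "j < n" "i \<noteq> j" for i j
      using that fin by (intro Min_le) auto
    ultimately show ?thesis using that by blast
  qed
  define a where "a = max_norm A"
  define b where "b = max_norm L"
  define v where "v = max_norm V"
  have nonneg: "0 \<le> a" "0 \<le> b" "0 \<le> v" by (simp_all add: a_def b_def v_def)
  \<comment> \<open>\<open>c4\<close> bounds the inverse of \<open>T' V\<close>, and \<open>c5 \<eta>\<close> the row sums of the perturbation of \<open>\<Lambda>\<close>\<close>
  define c4 where "c4 = n * 2 * (N * b)"
  define c5 where "c5 = n * (n * c4 * (N * (N * a)))"
  define K where "K = c5 + n * (v + 1) * (2 * c5 / d) + 1"
  have c: "0 \<le> c4" "0 \<le> c5" using nonneg by (simp_all add: c4_def c5_def)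
  have K: "K > 0" "c5 \<le> K" 
    using c nonneg d(1) by (auto simp: K_def intro!: add_nonneg_pos add_nonneg_nonneg)
  \<comment> \<open>the three bounds keep \<open>E\<close> bounded, make \<open>1 - L E\<close> invertible, and make the perturbation small
      against the gap \<open>d\<close>\<close>
  define \<eta>0 where "\<eta>0 = min 1 (min (1 / (2 * (n * (N * b)) + 1)) (d / (8 * (c5 + 1))))"
  have \<eta>0: "\<eta>0 > 0" using nonneg c d(1) by (simp add: \<eta>0_def add_nonneg_pos)
  have key: "\<exists>\<pi> c. \<pi> permutes {..<n} \<and> (\<forall>j<n. c j \<noteq> 0) \<and>
        max_norm (mat n n (\<lambda>(i, j). D $$ (\<pi> i, \<pi> j)) - mat_diag n l) \<le> K * \<eta> \<and>
        max_norm (mat N n (\<lambda>(i, j). c j * (T * P) $$ (i, \<pi> j)) - V) \<le> K * \<eta>"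
    if T: "T \<in> carrier_mat N n" and T': "T' \<in> carrier_mat n N"
      and nT: "max_norm T \<le> 1" and nT': "max_norm T' \<le> 1"
      and res: "max_norm (V - T * (T' * V)) \<le> \<eta>" and \<eta>: "\<eta> \<le> \<eta>0"
      and eig: "eigendecomposition (T' * A * T) P D"
    for T T' P D \<eta>
  proof -
    define E where "E = V - T * (T' * V)"
    define W where "W = T' * V"
    define At where "At = T' * A * T"
    have E: "E \<in> carrier_mat N n" and W: "W \<in> carrier_mat n n" and At: "At \<in> carrier_mat n n"
      using T T' V A by (auto simp: E_def W_def At_def minus_carrier_mat)
    have nE: "max_norm E \<le> \<eta>" using res by (simp add: E_def)
    have \<eta>nn: "0 \<le> \<eta>" using nE max_norm_nonneg order_trans by blast
    have TW: "T * W = V - E"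
      unfolding E_def W_def using T T' V by (intro eq_matI) (auto simp del: index_mult_mat(1))
    from eig At have P: "P \<in> carrier_mat n n" and D: "D \<in> carrier_mat n n" "diagonal_mat D"
      and invP: "invertible_mat P" and PD: "At * P = P * D"
      by (auto simp: eigendecomposition_def At_def[symmetric])
    have l_c: "mat_diag n l \<in> carrier_mat n n" by simp
    \<comment> \<open>\<open>T' V\<close> is invertible, since \<open>L T\<close> is almost a left inverse of it\<close>
    have LE: "L * E \<in> carrier_mat n n" using L E by simp
    have HW: "(L * T) * W = 1\<^sub>m n - L * E"
    proof -
      have "(L * T) * W = L * (V - E)" using assoc_mult_mat[OF L T W] TW by simp
      also have "\<dots> = L * V - L * E" by (rule mult_minus_distrib_mat[OF L V E])
      finally show ?thesis by (simp add: LV)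
    qed
    have "n * max_norm (L * E) \<le> n * (N * b * \<eta>)"
      using max_norm_mult_mono[OF L E _ nE, of b] by (intro mult_left_mono) (auto simp: b_def)
    also have "\<dots> \<le> 1 / 2"
    proof -
      have "(2 * (n * (N * b)) + 1) * \<eta> \<le> 1"
      proof -
        have p: "0 < 2 * (n * (N * b)) + 1" using nonneg by (simp add: add_nonneg_pos)
        have "\<eta> \<le> 1 / (2 * (n * (N * b)) + 1)" using \<eta> by (simp add: \<eta>0_def)
        then show ?thesis using p by (simp add: field_simps)
      qed
      then have "2 * (n * (N * b) * \<eta>) + \<eta> \<le> 1" by (simp add: algebra_simps)
      then show ?thesis using \<eta>nn by (simp add: mult_ac)
    qed
    finally obtain Z where Z: "Z \<in> carrier_mat n n" "Z * (1\<^sub>m n - L * E) = 1\<^sub>m n" "max_norm Z \<le> 2"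
      using near_identity_inverse[OF LE] by blast
    define U where "U = Z * (L * T)"
    have LT: "L * T \<in> carrier_mat n n" using L T by simp
    have U: "U \<in> carrier_mat n n" using Z LT by (simp add: U_def)
    have UW: "U * W = 1\<^sub>m n" unfolding U_def using assoc_mult_mat[OF Z(1) LT W] HW Z(2) by simp
    have WU: "W * U = 1\<^sub>m n" by (rule mat_mult_left_right_inverse[OF U W UW])
    have nU: "max_norm U \<le> c4"
      unfolding U_def c4_def
      using max_norm_mult_mono[OF Z(1) LT Z(3) max_norm_mult_mono[OF L T _ nT, of b]]
      by (simp add: b_def)
    \<comment> \<open>the reduced matrix is similar to a perturbation of \<open>\<Lambda>\<close>\<close>
    define F where "F = T' * (A * E)"
    have AE: "A * E \<in> carrier_mat N n" using A E by simp
    have F: "F \<in> carrier_mat n n" using T' AE by (simp add: F_def)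
    have nF: "max_norm F \<le> N * (N * a * \<eta>)"
      unfolding F_def using max_norm_mult_mono[OF T' AE nT' max_norm_mult_mono[OF A E _ nE, of a]]
      by (simp add: a_def)
    have AtW: "At * W = W * mat_diag n l - F"
    proof -
      have "At * W = T' * A * (V - E)"
        unfolding At_def using assoc_mult_mat[OF mult_carrier_mat[OF T' A] T W] TW by simp
      also have "\<dots> = T' * A * V - T' * A * E"
        by (rule mult_minus_distrib_mat[OF mult_carrier_mat[OF T' A] V E])
      also have "T' * A * V = W * mat_diag n l"
        unfolding W_def using assoc_mult_mat[OF T' A V] AV assoc_mult_mat[OF T' V l_c] by simp
      also have "T' * A * E = F" unfolding F_def by (rule assoc_mult_mat[OF T' A E])
      finally show ?thesis .
    qed
    define G where "G = - (U * F)"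
    have UF: "U * F \<in> carrier_mat n n" using U F by simp
    have G: "G \<in> carrier_mat n n" using UF by (simp add: G_def)
    have sim: "U * (At * W) = mat_diag n l + G"
    proof -
      have "U * (At * W) = U * (W * mat_diag n l) - U * F"
        unfolding AtW by (rule mult_minus_distrib_mat[OF U mult_carrier_mat[OF W l_c] F])
      also have "U * (W * mat_diag n l) = mat_diag n l"
        using assoc_mult_mat[OF U W l_c] UW left_mult_one_mat[OF l_c] by simp
      also have "mat_diag n l - U * F = mat_diag n l + G"
        unfolding G_def using UF by (intro minus_add_uminus_mat[of _ n n]) auto
      finally show ?thesis .
    qed
    define Y where "Y = U * P"
    have Y: "Y \<in> carrier_mat n n" using U P by (simp add: Y_def)
    have WY: "W * Y = P"
      unfolding Y_def using assoc_mult_mat[OF W U P] WU left_mult_one_mat[OF P] by simp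
    have eqY: "(mat_diag n l + G) * Y = Y * D"
    proof -
      have "(mat_diag n l + G) * Y = U * ((At * W) * Y)"
        unfolding sim[symmetric] by (rule assoc_mult_mat[OF U mult_carrier_mat[OF At W] Y])
      also have "(At * W) * Y = P * D" using assoc_mult_mat[OF At W Y] WY PD by simp
      also have "U * (P * D) = Y * D" unfolding Y_def using assoc_mult_mat[OF U P D(1)] by simp
      finally show ?thesis .
    qed
    have detY: "det Y \<noteq> 0"
    proof -
      obtain B where "B \<in> carrier_mat n n" "P * B = 1\<^sub>m n"
        using invertible_mat_inverse[OF P invP] by blast
      then have "det P \<noteq> 0" using det_mult[OF P, of B] by auto
      moreover have "det P = det W * det Y" unfolding WY[symmetric] by (rule det_mult[OF W Y])
      ultimately show ?thesis by auto
    qed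
    define \<rho> where "\<rho> = c5 * \<eta>"
    have nG: "max_norm G \<le> n * c4 * (N * (N * a * \<eta>))"
      unfolding G_def using max_norm_uminus[OF UF] max_norm_mult_mono[OF U F nU nF] by linarith
    have rows: "(\<Sum>k<n. cmod (G $$ (i, k))) \<le> \<rho>" if "i < n" for i
    proof -
      have "(\<Sum>k<n. cmod (G $$ (i, k))) \<le> (\<Sum>k<n. n * c4 * (N * (N * a * \<eta>)))"
        using that G nG by (intro sum_mono order_trans[OF norm_entry_le_max_norm nG]) auto
      then show ?thesis by (simp add: \<rho>_def c5_def mult_ac)
    qed
    have \<rho>0: "0 \<le> \<rho>" using c \<eta>nn by (simp add: \<rho>_def)
    have \<rho>d: "4 * \<rho> < d"
    proof -
      have "\<eta> \<le> d / (8 * (c5 + 1))" using \<eta> by (simp add: \<eta>0_def)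
      then have "8 * (c5 + 1) * \<eta> \<le> d" using c by (simp add: field_simps)
      then have "8 * \<rho> + 8 * \<eta> \<le> d" by (simp add: \<rho>_def algebra_simps)
      then show ?thesis using \<rho>0 \<eta>nn d(1) by linarith
    qed
    from perturbed_diagonal_eigenbasis[OF G Y D detY eqY d(2) rows \<rho>0 \<rho>d]
    obtain \<pi> c where \<pi>: "\<pi> permutes {..<n}"
      and cj: "\<And>j. j < n \<Longrightarrow> c j \<noteq> 0" "\<And>j. j < n \<Longrightarrow> cmod (D $$ (\<pi> j, \<pi> j) - l j) \<le> \<rho>"
        "\<And>i j. i < n \<Longrightarrow> j < n \<Longrightarrow> cmod (c j * Y $$ (i, \<pi> j) - (if i = j then 1 else 0)) \<le> 2 * \<rho> / d"
      by blast
    have \<pi>n: "\<pi> j < n" if "j < n" for j using permutes_in_image[OF \<pi>, of j] that by simp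
    have "max_norm (mat n n (\<lambda>(i, j). D $$ (\<pi> i, \<pi> j)) - mat_diag n l) \<le> \<rho>"
    proof (rule max_norm_leI[OF \<rho>0])
      fix i j assume "i < dim_row (mat n n (\<lambda>(i, j). D $$ (\<pi> i, \<pi> j)) - mat_diag n l)"
        "j < dim_col (mat n n (\<lambda>(i, j). D $$ (\<pi> i, \<pi> j)) - mat_diag n l)"
      then have ij: "i < n" "j < n" by (auto simp: mat_diag_def)
      have "D $$ (\<pi> i, \<pi> j) = 0" if "i \<noteq> j"
        using D ij \<pi>n that permutes_inj[OF \<pi>] by (auto simp: diagonal_mat_def inj_eq)
      then show "cmod ((mat n n (\<lambda>(i, j). D $$ (\<pi> i, \<pi> j)) - mat_diag n l) $$ (i, j)) \<le> \<rho>"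
        using ij cj(2)[of j] \<rho>0 by (cases "i = j") (auto simp: mat_diag_def)
    qed
    also have "\<rho> \<le> K * \<eta>" unfolding \<rho>_def using K \<eta>nn by (intro mult_right_mono) auto
    finally have 1: "max_norm (mat n n (\<lambda>(i, j). D $$ (\<pi> i, \<pi> j)) - mat_diag n l) \<le> K * \<eta>" .
    define Q where "Q = mat n n (\<lambda>(i, j). c j * Y $$ (i, \<pi> j)) - 1\<^sub>m n"
    have Q: "Q \<in> carrier_mat n n" by (simp add: Q_def minus_carrier_mat)
    have nQ: "max_norm Q \<le> 2 * \<rho> / d"
      using cj(3) \<rho>0 d(1) by (intro max_norm_leI) (auto simp: Q_def)
    have VE: "V - E \<in> carrier_mat N n" using E by (simp add: minus_carrier_mat)
    have TP: "T * P = (V - E) * Y" using assoc_mult_mat[OF T W Y] TW WY by simp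
    have Vr: "mat N n (\<lambda>(i, j). c j * (T * P) $$ (i, \<pi> j)) - V = (V - E) * Q - E"
    proof (rule eq_matI)
      fix i j assume "i < dim_row ((V - E) * Q - E)" "j < dim_col ((V - E) * Q - E)"
      then have ij: "i < N" "j < n" using E by auto
      have "((V - E) * Q) $$ (i, j) = (\<Sum>k<n. (V - E) $$ (i, k) * Q $$ (k, j))"
        by (rule mult_mat_entry[OF VE Q ij])
      also have "\<dots> = (\<Sum>k<n. c j * ((V - E) $$ (i, k) * Y $$ (k, \<pi> j)) -
          (if k = j then (V - E) $$ (i, k) else 0))"
        using ij by (intro sum.cong refl) (auto simp: Q_def algebra_simps)
      also have "\<dots> = c j * (\<Sum>k<n. (V - E) $$ (i, k) * Y $$ (k, \<pi> j)) - (V - E) $$ (i, j)"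
        using ij by (simp only: sum_subtractf sum_distrib_left[symmetric]) simp
      also have "(\<Sum>k<n. (V - E) $$ (i, k) * Y $$ (k, \<pi> j)) = (T * P) $$ (i, \<pi> j)"
        unfolding TP using mult_mat_entry[OF VE Y ij(1) \<pi>n[OF ij(2)]] by simp
      finally show "(mat N n (\<lambda>(i, j). c j * (T * P) $$ (i, \<pi> j)) - V) $$ (i, j) =
          ((V - E) * Q - E) $$ (i, j)"
        using ij V E Q by (simp del: index_mult_mat(1))
    qed (use E V in auto)
    have "max_norm (V - E) \<le> v + 1"
      using max_norm_minus[OF V E] nE \<eta> by (simp add: v_def \<eta>0_def)
    then have "max_norm ((V - E) * Q) \<le> n * (v + 1) * (2 * \<rho> / d)"
      using max_norm_mult_mono[OF VE Q _ nQ] by blast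
    then have "max_norm (mat N n (\<lambda>(i, j). c j * (T * P) $$ (i, \<pi> j)) - V) \<le>
        n * (v + 1) * (2 * \<rho> / d) + \<eta>"
      unfolding Vr using max_norm_minus[OF mult_carrier_mat[OF VE Q] E] nE by linarith
    also have "\<dots> = (n * (v + 1) * (2 * c5 / d) + 1) * \<eta>" by (simp add: \<rho>_def algebra_simps)
    also have "\<dots> \<le> K * \<eta>" unfolding K_def using c \<eta>nn by (intro mult_right_mono) auto
    finally show ?thesis using 1 \<pi> cj(1) by blast
  qed
  then show ?thesis using \<eta>0 K(1) by blast
qed

section \<open>Orthogonal diagonalization of real symmetric matrices\<close>

text \<open>Gram-Schmidt applied to a basis that starts with \<open>v\<close>, followed by normalization of the columns.\<close>
lemma orthonormal_completion:
  fixes v :: "real vec"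
  assumes v: "v \<in> carrier_vec m" and v0: "v \<noteq> 0\<^sub>v m"
  obtains W s where "W \<in> carrier_mat m m" "W\<^sup>T * W = 1\<^sub>m m" "col W 0 = s \<cdot>\<^sub>v v"
proof -
  interpret cof_vec_space m "TYPE(real)" .
  have m: "0 < m" using v v0 by (cases m) auto
  define b where "b = basis_completion v"
  from basis_completion[OF v v0, folded b_def]
  have dist_b: "distinct b" and indep: "\<not> lin_dep (set b)" and b: "set b \<subseteq> carrier_vec m"
    and hdb: "hd b = v" and len_b: "length b = m" by auto
  from hdb len_b m obtain vs where bv: "b = v # vs" by (cases b) auto
  define ws where "ws = gram_schmidt m b"
  from gram_schmidt_result[OF b dist_b indep refl, folded ws_def]
  have ws: "set ws \<subseteq> carrier_vec m" "corthogonal ws" "length ws = m"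
    by (auto simp: len_b)
  have ws0: "ws ! 0 = v"
    using gram_schmidt_hd[OF v, of vs, folded bv] ws(3) m
    by (metis hd_conv_nth list.size(3) not_less0 ws_def)
  have wsc: "ws ! i \<in> carrier_vec m" if "i < m" for i using ws that by (metis nth_mem subset_code(1))
  have conj: "conjugate w = w" for w :: "real vec" by (intro eq_vecI) auto
  have orth: "(\<Sum>k<m. ws ! i $ k * ws ! j $ k) = 0 \<longleftrightarrow> i \<noteq> j" if "i < m" "j < m" for i j
  proof -
    have "ws ! i \<bullet>c ws ! j = (\<Sum>k<m. ws ! i $ k * ws ! j $ k)"
      using wsc[OF that(2)] by (simp add: scalar_prod_def conj atLeast0LessThan)
    then show ?thesis using corthogonalD[OF ws(2), of i j] ws(3) that by simp
  qed
  define q where "q i = (\<Sum>k<m. ws ! i $ k * ws ! i $ k)" for i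
  have q: "q i > 0" if "i < m" for i
    using orth[OF that that] sum_nonneg[of "{..<m}" "\<lambda>k. ws ! i $ k * ws ! i $ k"]
    by (fastforce simp: q_def)
  define W where "W = mat m m (\<lambda>(k, i). ws ! i $ k / sqrt (q i))"
  have W: "W \<in> carrier_mat m m" by (simp add: W_def)
  have "W\<^sup>T * W = 1\<^sub>m m"
  proof (rule eq_matI)
    fix i j assume ij: "i < dim_row (1\<^sub>m m :: real mat)" "j < dim_col (1\<^sub>m m :: real mat)"
    have "(W\<^sup>T * W) $$ (i, j) = (\<Sum>k<m. (ws ! i $ k * ws ! j $ k) / (sqrt (q i) * sqrt (q j)))"
      using ij by (simp add: W_def scalar_prod_def atLeast0LessThan)
    also have "\<dots> = (\<Sum>k<m. ws ! i $ k * ws ! j $ k) / (sqrt (q i) * sqrt (q j))"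
      by (simp add: sum_divide_distrib)
    also have "\<dots> = (1\<^sub>m m) $$ (i, j)"
    proof (cases "i = j")
      case True
      then show ?thesis using ij q[of i] by (simp add: q_def[symmetric])
    next
      case False
      then show ?thesis using ij orth[of i j] by simp
    qed
    finally show "(W\<^sup>T * W) $$ (i, j) = (1\<^sub>m m) $$ (i, j)" .
  qed (use W in auto)
  moreover have "col W 0 = (1 / sqrt (q 0)) \<cdot>\<^sub>v v"
    using m v by (intro eq_vecI) (auto simp: W_def ws0)
  ultimately show ?thesis using that W by blast
qed

text \<open>Deflation. An orthonormal basis whose first vector is a unit eigenvector for the first root \<open>e\<close>
transforms \<open>G\<close> into a symmetric matrix whose first column, hence also first row, is \<open>e\<close> followed by
zeros; the remaining diagonal block is symmetric and its characteristic polynomial has the remaining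
roots. The eigenvectors come out in the order in which the roots are listed, which is what makes
``the first \<open>n\<close> eigenvalues'' meaningful for a decreasing list.\<close>
theorem symmetric_orthogonal_diagonalization:
  fixes G :: "real mat"
  assumes "G \<in> carrier_mat m m" "G\<^sup>T = G" "char_poly G = (\<Prod>e \<leftarrow> es. [:- e, 1:])"
  shows "length es = m \<and>
    (\<exists>P \<in> carrier_mat m m. P\<^sup>T * P = 1\<^sub>m m \<and> G * P = P * mat_diag m (\<lambda>i. es ! i))"
  using assms
proof (induction es arbitrary: G m)
  case Nil
  then have "m = 0" using degree_monic_char_poly[of G m] by auto
  then show ?case using Nil by (auto intro!: bexI[of _ "1\<^sub>m 0"] simp: mat_diag_def)
next
  case (Cons e es G m)
  note G = Cons.prems(1)
  let ?n1 = "m - 1"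
  have cp: "char_poly G = [:- e, 1:] * (\<Prod>e \<leftarrow> es. [:- e, 1:])" using Cons.prems(3) by simp
  have mon: "monic (\<Prod>e\<leftarrow>es. [:- e, 1:])" by (rule monic_prod_list) auto
  have "degree (char_poly G) = Suc (degree (\<Prod>e\<leftarrow>es. [:- e, 1:]))"
    unfolding cp by (subst degree_mult_eq, insert mon, auto)
  then have m: "m \<noteq> 0" using degree_monic_char_poly[OF G] by auto
  have "eigenvalue G e" unfolding eigenvalue_root_char_poly[OF G] cp by simp
  then obtain v where v: "v \<in> carrier_vec m" "v \<noteq> 0\<^sub>v m" "G *\<^sub>v v = e \<cdot>\<^sub>v v"
    using G by (auto simp: eigenvalue_def eigenvector_def)
  from orthonormal_completion[OF v(1,2)] obtain W s
    where W: "W \<in> carrier_mat m m" and WW: "W\<^sup>T * W = 1\<^sub>m m" and W0: "col W 0 = s \<cdot>\<^sub>v v" by blast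
  have Wt: "W\<^sup>T \<in> carrier_mat m m" using W by simp
  have WW': "W * W\<^sup>T = 1\<^sub>m m" by (rule mat_mult_left_right_inverse[OF Wt W WW])
  define K where "K = W\<^sup>T * G * W"
  have K: "K \<in> carrier_mat m m" using W G by (simp add: K_def)
  have Ksym: "K\<^sup>T = K"
    using W G Cons.prems(2) unfolding K_def
    by (simp add: transpose_mult[of _ m m _ m] assoc_mult_mat[of _ m m _ m _ m])
  have Kij: "K $$ (i, j) = K $$ (j, i)" if "i < m" "j < m" for i j
    using arg_cong[OF Ksym, of "\<lambda>M. M $$ (i, j)"] K that by simp
  have GW: "G * W = W * K"
  proof -
    have "W * K = (W * W\<^sup>T) * (G * W)"
      unfolding K_def using W G by (simp add: assoc_mult_mat[of _ m m _ m _ m])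
    then show ?thesis using W G by (simp add: WW')
  qed
  have K0: "K $$ (i, 0) = (if i = 0 then e else 0)" if i: "i < m" for i
  proof -
    have "K = W\<^sup>T * (G * W)" unfolding K_def using W G by (simp add: assoc_mult_mat[of _ m m _ m _ m])
    then have "K $$ (i, 0) = row W\<^sup>T i \<bullet> col (G * W) 0" using i m W G by simp
    also have "col (G * W) 0 = G *\<^sub>v col W 0" using m by (intro col_mult2[OF G W]) simp
    also have "\<dots> = e \<cdot>\<^sub>v col W 0"
      unfolding W0 using v G by (simp add: mult_mat_vec smult_smult_assoc mult.commute)
    also have "row W\<^sup>T i \<bullet> (e \<cdot>\<^sub>v col W 0) = e * (row W\<^sup>T i \<bullet> col W 0)"
      using W m i by (intro scalar_prod_smult_distrib[of _ m]) auto
    also have "row W\<^sup>T i \<bullet> col W 0 = (W\<^sup>T * W) $$ (i, 0)" using W m i by simp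
    finally show ?thesis using i m by (simp add: WW)
  qed
  define K2 where "K2 = mat ?n1 ?n1 (\<lambda>(i, j). K $$ (Suc i, Suc j))"
  have K2: "K2 \<in> carrier_mat ?n1 ?n1" by (simp add: K2_def)
  define E where "E = mat 1 1 (\<lambda>_. e)"
  have Kblock: "K = four_block_mat E (0\<^sub>m 1 ?n1) (0\<^sub>m ?n1 1) K2"
  proof (rule eq_matI)
    fix i j assume "i < dim_row (four_block_mat E (0\<^sub>m 1 ?n1) (0\<^sub>m ?n1 1) K2)"
      "j < dim_col (four_block_mat E (0\<^sub>m 1 ?n1) (0\<^sub>m ?n1 1) K2)"
    then have ij: "i < m" "j < m" using m by (auto simp: K2_def E_def)
    show "K $$ (i, j) = four_block_mat E (0\<^sub>m 1 ?n1) (0\<^sub>m ?n1 1) K2 $$ (i, j)"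
      using ij K0[of i] K0[of j] Kij[of i j] by (cases i; cases j) (auto simp: K2_def E_def)
  qed (use K m in \<open>auto simp: K2_def E_def\<close>)
  have "similar_mat_wit K G W\<^sup>T W"
    by (rule similar_mat_witI[of _ _ m]) (use W G K WW WW' in \<open>auto simp: K_def\<close>)
  then have "char_poly K = char_poly G" by (intro char_poly_similar) (auto simp: similar_mat_def)
  moreover have "char_poly K = char_poly E * char_poly K2"
    unfolding Kblock by (rule char_poly_four_block_zeros_col) (auto simp: E_def K2_def)
  moreover have "char_poly E = [:- e, 1:]"
    by (simp add: E_def char_poly_defs det_def sign_def)
  ultimately have cp2: "char_poly K2 = (\<Prod>e \<leftarrow> es. [:- e, 1:])"
    using cp by (metis mult_cancel_left pCons_eq_0_iff zero_neq_one)
  have K2sym: "K2\<^sup>T = K2" using Kij by (intro eq_matI) (auto simp: K2_def)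
  from Cons.IH[OF K2 K2sym cp2] obtain P where len: "length es = ?n1"
    and P: "P \<in> carrier_mat ?n1 ?n1" "P\<^sup>T * P = 1\<^sub>m ?n1"
      "K2 * P = P * mat_diag ?n1 (\<lambda>i. es ! i)" by blast
  let ?P = "four_block_mat (1\<^sub>m 1) (0\<^sub>m 1 ?n1) (0\<^sub>m ?n1 1) P"
  let ?D = "mat_diag ?n1 (\<lambda>i. es ! i)"
  have Pc: "?P \<in> carrier_mat m m"
    using four_block_carrier_mat[of "1\<^sub>m 1" 1 1 P ?n1 ?n1] P(1) m by simp
  have D: "mat_diag m (\<lambda>i. (e # es) ! i) = four_block_mat E (0\<^sub>m 1 ?n1) (0\<^sub>m ?n1 1) ?D"
    using m by (intro eq_matI) (auto simp: mat_diag_def E_def nth_Cons' )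
  have Pt: "?P\<^sup>T = four_block_mat (1\<^sub>m 1) (0\<^sub>m 1 ?n1) (0\<^sub>m ?n1 1) P\<^sup>T"
    using P(1) by (subst transpose_four_block_mat) auto
  have Ec: "E \<in> carrier_mat 1 1" by (simp add: E_def)
  have PP: "?P\<^sup>T * ?P = 1\<^sub>m m"
  proof -
    have "?P\<^sup>T * ?P = four_block_mat (1\<^sub>m 1) (0\<^sub>m 1 ?n1) (0\<^sub>m ?n1 1) (P\<^sup>T * P)"
      unfolding Pt using P(1) by (subst mult_four_block_mat[of _ 1 1 _ ?n1 _ ?n1]) auto
    then show ?thesis using m by (simp add: P(2))
  qed
  have KP: "K * ?P = ?P * mat_diag m (\<lambda>i. (e # es) ! i)"
  proof -
    have "K * ?P = four_block_mat E (0\<^sub>m 1 ?n1) (0\<^sub>m ?n1 1) (K2 * P)"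
      unfolding Kblock using P(1) K2 Ec by (subst mult_four_block_mat[of _ 1 1 _ ?n1 _ ?n1]) auto
    moreover have "?P * mat_diag m (\<lambda>i. (e # es) ! i) =
        four_block_mat E (0\<^sub>m 1 ?n1) (0\<^sub>m ?n1 1) (P * ?D)"
      unfolding D using P(1) Ec left_mult_zero_mat[OF mat_diag_dim[of ?n1 "\<lambda>i. es ! i"]]
      by (subst mult_four_block_mat[of _ 1 1 _ ?n1 _ ?n1]) auto
    ultimately show ?thesis using P(3) by simp
  qed
  have Dm: "mat_diag m (\<lambda>i. (e # es) ! i) \<in> carrier_mat m m" by simp
  show ?case
  proof (intro conjI bexI[of _ "W * ?P"])
    show "length (e # es) = m" using len m by simp
    show "W * ?P \<in> carrier_mat m m" using W Pc by simp
    have "(W * ?P)\<^sup>T * (W * ?P) = ?P\<^sup>T * (W\<^sup>T * W) * ?P"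
      using W Pc by (simp add: transpose_mult[of _ m m _ m] assoc_mult_mat[of _ m m _ m _ m])
    then show "(W * ?P)\<^sup>T * (W * ?P) = 1\<^sub>m m" 
      by (simp only: WW right_mult_one_mat[OF transpose_carrier_mat[THEN iffD2, OF Pc]] PP)
    have "G * (W * ?P) = (G * W) * ?P"
      using G W Pc by (simp add: assoc_mult_mat[of _ m m _ m _ m])
    also have "\<dots> = W * (K * ?P)"
      unfolding GW using K W Pc by (simp add: assoc_mult_mat[of _ m m _ m _ m])
    also have "\<dots> = W * ?P * mat_diag m (\<lambda>i. (e # es) ! i)"
      unfolding KP using W Pc Dm by (simp add: assoc_mult_mat[of _ m m _ m _ m])
    finally show "G * (W * ?P) = W * ?P * mat_diag m (\<lambda>i. (e # es) ! i)" .
  qed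
qed

section \<open>The residual of snapshot POD\<close>

text \<open>Pythagoras for a real matrix with orthogonal columns of squared lengths \<open>e k\<close>, applied to a complex
coefficient vector.\<close>
lemma orthogonal_columns_norm:
  fixes B :: "real mat" and c :: "nat \<Rightarrow> complex"
  assumes B: "B \<in> carrier_mat N m" and BB: "B\<^sup>T * B = mat_diag m e"
  shows "(\<Sum>i<N. (cmod (\<Sum>k<m. of_real (B $$ (i, k)) * c k))\<^sup>2) = (\<Sum>k<m. e k * (cmod (c k))\<^sup>2)"
proof -
  have dot: "(\<Sum>i<N. B $$ (i, k) * B $$ (i, l)) = (if k = l then e k else 0)" if "k < m" "l < m" for k l
    using arg_cong[OF BB, of "\<lambda>M. M $$ (k, l)"] that B
    by (simp add: mat_diag_def scalar_prod_def atLeast0LessThan)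
  have "complex_of_real (\<Sum>i<N. (cmod (\<Sum>k<m. of_real (B $$ (i, k)) * c k))\<^sup>2) =
      (\<Sum>i<N. (\<Sum>k<m. of_real (B $$ (i, k)) * c k) * (\<Sum>l<m. of_real (B $$ (i, l)) * cnj (c l)))"
    unfolding of_real_sum
    by (intro sum.cong refl)
      (simp only: complex_norm_square cnj_sum complex_cnj_mult complex_cnj_complex_of_real)
  also have "\<dots> = (\<Sum>i<N. \<Sum>k<m. \<Sum>l<m. c k * cnj (c l) * of_real (B $$ (i, k) * B $$ (i, l)))"
    by (simp add: sum_product mult_ac)
  also have "\<dots> = (\<Sum>k<m. \<Sum>l<m. \<Sum>i<N. c k * cnj (c l) * of_real (B $$ (i, k) * B $$ (i, l)))"
    by (subst sum.swap) (intro sum.cong refl sum.swap)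
  also have "\<dots> = (\<Sum>k<m. \<Sum>l<m. c k * cnj (c l) * of_real (\<Sum>i<N. B $$ (i, k) * B $$ (i, l)))"
    by (simp only: sum_distrib_left of_real_sum)
  also have "\<dots> = (\<Sum>k<m. \<Sum>l<m. if k = l then c k * cnj (c l) * of_real (e k) else 0)"
    by (intro sum.cong refl) (simp add: dot)
  also have "\<dots> = (\<Sum>k<m. of_real (e k * (cmod (c k))\<^sup>2))"
    by (intro sum.cong refl) (simp add: complex_norm_square mult_ac del: of_real_power)
  finally show ?thesis by (simp only: of_real_sum[symmetric] of_real_eq_iff)
qed

lemma square_sum_le:
  fixes f :: "nat \<Rightarrow> real"
  shows "(\<Sum>j<m. f j)\<^sup>2 \<le> real m * (\<Sum>j<m. (f j)\<^sup>2)"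
proof -
  have "(\<Sum>j<m. f j)\<^sup>2 = (\<Sum>j<m. \<Sum>k<m. f j * f k)"
    by (simp add: power2_eq_square sum_product)
  also have "\<dots> \<le> (\<Sum>j<m. \<Sum>k<m. ((f j)\<^sup>2 + (f k)\<^sup>2) / 2)"
    using sum_squares_bound by (intro sum_mono) (simp add: field_simps)
  also have "\<dots> = m * (\<Sum>j<m. (f j)\<^sup>2)"
    by (simp add: sum_divide_distrib[symmetric] sum.distrib sum_distrib_left[symmetric])
  finally show ?thesis .
qed

text \<open>\<open>n\<close> equations in \<open>n + 1\<close> unknowns: a zero row makes the coefficient matrix square and singular.\<close>
lemma wide_system_nontrivial_kernel:
  fixes F :: "nat \<Rightarrow> nat \<Rightarrow> complex"
  obtains c where "\<exists>k\<le>n. c k \<noteq> 0" "\<And>i. i < n \<Longrightarrow> (\<Sum>k\<le>n. F i k * c k) = 0"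
proof -
  define M where "M = mat (Suc n) (Suc n) (\<lambda>(i, k). if i < n then F i k else 0)"
  have M: "M \<in> carrier_mat (Suc n) (Suc n)" by (simp add: M_def)
  have "M\<^sup>T *\<^sub>v unit_vec (Suc n) n = 0\<^sub>v (Suc n)"
    by (intro eq_vecI) (auto simp: M_def)
  then have "\<exists>v. v \<in> carrier_vec (Suc n) \<and> v \<noteq> 0\<^sub>v (Suc n) \<and> M\<^sup>T *\<^sub>v v = 0\<^sub>v (Suc n)"
    by (intro exI[of _ "unit_vec (Suc n) n"]) simp
  then have "det M\<^sup>T = 0"
    using det_0_iff_vec_prod_zero[of "M\<^sup>T" "Suc n"] M by simp
  then have "det M = 0" using det_transpose[OF M] by simp
  then obtain v where v: "v \<in> carrier_vec (Suc n)" "v \<noteq> 0\<^sub>v (Suc n)" "M *\<^sub>v v = 0\<^sub>v (Suc n)"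
    using det_0_iff_vec_prod_zero[OF M] by blast
  have "\<exists>k\<le>n. v $ k \<noteq> 0"
    using v(1,2) by (metis carrier_vecD eq_vecI index_zero_vec less_Suc_eq_le)
  moreover have "(\<Sum>k\<le>n. F i k * v $ k) = 0" if "i < n" for i
    using arg_cong[OF v(3), of "\<lambda>w. w $ i"] that v(1)
    by (simp add: M_def scalar_prod_def atLeast0LessThan lessThan_Suc_atMost)
  ultimately show ?thesis by (rule that)
qed

text \<open>The part of the Courant-Fischer principle that is needed: on the span of the first \<open>n + 1\<close>
eigenvectors, \<open>\<parallel>X w\<parallel>\<^sup>2 \<ge> e n \<parallel>w\<parallel>\<^sup>2\<close>. Because \<open>\<alpha>\<close> has only \<open>n\<close> rows, this span contains a nonzero
\<open>w\<close> with \<open>\<alpha> w = 0\<close>, and then \<open>X w = \<Delta> w\<close>, whose square is at most \<open>N m (max_norm \<Delta>)\<^sup>2 \<parallel>w\<parallel>\<^sup>2\<close>.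
The vector \<open>w\<close> is complex in general, although \<open>X\<close> and its eigenvectors are real.\<close>
lemma eigenvalue_beyond_rank_le:
  fixes X P :: "real mat" and Y \<alpha> \<Delta> :: "complex mat"
  assumes X: "X \<in> carrier_mat N m" and P: "P \<in> carrier_mat m m" "P\<^sup>T * P = 1\<^sub>m m"
    and eig: "(X\<^sup>T * X) * P = P * mat_diag m e"
    and Y: "Y \<in> carrier_mat N n" and \<alpha>: "\<alpha> \<in> carrier_mat n m" and \<Delta>: "\<Delta> \<in> carrier_mat N m"
    and split: "cmat X = Y * \<alpha> + \<Delta>"
    and n: "n < m" and dec: "\<And>k. k \<le> n \<Longrightarrow> e n \<le> e k"
  shows "e n \<le> real N * real m * (max_norm \<Delta>)\<^sup>2"
proof -
  obtain c where c: "\<exists>k\<le>n. c k \<noteq> 0"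
    "\<And>i. i < n \<Longrightarrow> (\<Sum>k\<le>n. (\<alpha> * cmat P) $$ (i, k) * c k) = 0"
    by (rule wide_system_nontrivial_kernel[where F = "\<lambda>i k. (\<alpha> * cmat P) $$ (i, k)"]) blast
  define d where "d k = (if k \<le> n then c k else 0)" for k
  define w where "w = cmat P *\<^sub>v vec m d"
  have w: "w \<in> carrier_vec m" using P by (simp add: w_def)
  have cP: "cmat P \<in> carrier_mat m m" using P by simp
  have "\<alpha> *\<^sub>v w = 0\<^sub>v n"
  proof (rule eq_vecI)
    fix i assume "i < dim_vec (0\<^sub>v n :: complex vec)"
    then have i: "i < n" by simp
    have "(\<alpha> *\<^sub>v w) $ i = ((\<alpha> * cmat P) *\<^sub>v vec m d) $ i"
      unfolding w_def using \<alpha> cP by (subst assoc_mult_mat_vec[of _ n m _ m]) auto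
    also have "\<dots> = (\<Sum>k<m. (\<alpha> * cmat P) $$ (i, k) * d k)"
      using i \<alpha> cP by (simp add: mult_mat_vec_def scalar_prod_def atLeast0LessThan)
    also have "\<dots> = (\<Sum>k\<le>n. (\<alpha> * cmat P) $$ (i, k) * c k)"
      using n by (intro sum.mono_neutral_cong_right) (auto simp: d_def)
    finally show "(\<alpha> *\<^sub>v w) $ i = 0\<^sub>v n $ i" using c(2)[OF i] i by simp
  qed (use \<alpha> in simp)
  then have "Y *\<^sub>v (\<alpha> *\<^sub>v w) = 0\<^sub>v N"
    using Y by (intro eq_vecI) (auto simp: scalar_prod_def)
  then have Xw: "cmat X *\<^sub>v w = \<Delta> *\<^sub>v w"
    unfolding split using Y \<alpha> \<Delta> w
    by (subst add_mult_distrib_mat_vec[of _ N m]) (auto simp: assoc_mult_mat_vec[of _ N n _ m])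
  define S where "S = (\<Sum>k<m. (cmod (d k))\<^sup>2)"
  have S: "S > 0"
  proof -
    obtain k where k: "k \<le> n" "c k \<noteq> 0" using c(1) by blast
    have "0 < (cmod (d k))\<^sup>2" using k by (simp add: d_def)
    also have "\<dots> \<le> S" unfolding S_def using k n by (intro member_le_sum) auto
    finally show ?thesis .
  qed
  have wi: "w $ j = (\<Sum>k<m. of_real (P $$ (j, k)) * d k)" if "j < m" for j
    using that P by (simp add: w_def scalar_prod_def atLeast0LessThan)
  have "P\<^sup>T * P = mat_diag m (\<lambda>_. 1)" using P by simp
  from orthogonal_columns_norm[OF P(1) this, of d]
  have wS: "(\<Sum>j<m. (cmod (w $ j))\<^sup>2) = S" using wi by (simp add: S_def)
  have XP: "X * P \<in> carrier_mat N m" using X P by simp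
  have "(X * P)\<^sup>T * (X * P) = P\<^sup>T * ((X\<^sup>T * X) * P)"
    using X P
    by (simp add: transpose_mult[OF X P(1)] assoc_mult_mat[of _ m N _ m _ m]
        assoc_mult_mat[of _ m m _ N _ m])
  also have "\<dots> = (P\<^sup>T * P) * mat_diag m e"
    unfolding eig using P(1) by (simp add: assoc_mult_mat[of _ m m _ m _ m])
  also have "\<dots> = mat_diag m e" using P(2) by (simp add: left_mult_one_mat[of _ m m])
  finally have XPe: "(X * P)\<^sup>T * (X * P) = mat_diag m e" .
  have zi: "(\<Delta> *\<^sub>v w) $ i = (\<Sum>k<m. of_real ((X * P) $$ (i, k)) * d k)" if "i < N" for i
  proof -
    have "cmat X *\<^sub>v w = (cmat X * cmat P) *\<^sub>v vec m d"
      unfolding w_def using X P by (subst assoc_mult_mat_vec[of _ N m _ m]) auto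
    also have "cmat X * cmat P = cmat (X * P)"
      using X P by (simp add: of_real_hom.mat_hom_mult[of _ N m _ m])
    finally have "(\<Delta> *\<^sub>v w) $ i = (\<Sum>k<m. cmat (X * P) $$ (i, k) * d k)"
      using Xw XP that mult_mat_vec_entry[of "cmat (X * P)" N m i d] by simp
    also have "\<dots> = (\<Sum>k<m. of_real ((X * P) $$ (i, k)) * d k)"
      using X P that by (intro sum.cong refl) (simp del: index_mult_mat(1))
    finally show ?thesis .
  qed
  have zb: "(cmod ((\<Delta> *\<^sub>v w) $ i))\<^sup>2 \<le> m * (max_norm \<Delta>)\<^sup>2 * S" if i: "i < N" for i
  proof -
    have "cmod ((\<Delta> *\<^sub>v w) $ i) \<le> (\<Sum>j<m. max_norm \<Delta> * cmod (w $ j))"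
      using i \<Delta> w
      by (auto simp: scalar_prod_def atLeast0LessThan norm_mult
          intro!: sum_norm_le mult_right_mono norm_entry_le_max_norm)
    then have *: "(cmod ((\<Delta> *\<^sub>v w) $ i))\<^sup>2 \<le> (max_norm \<Delta> * (\<Sum>j<m. cmod (w $ j)))\<^sup>2"
      by (intro power_mono) (auto simp: sum_distrib_left)
    have "(\<Sum>j<m. cmod (w $ j))\<^sup>2 \<le> m * S"
      unfolding wS[symmetric] by (rule square_sum_le)
    then have "(max_norm \<Delta>)\<^sup>2 * (\<Sum>j<m. cmod (w $ j))\<^sup>2 \<le> (max_norm \<Delta>)\<^sup>2 * (m * S)"
      by (intro mult_left_mono) auto
    with * show ?thesis by (simp add: power_mult_distrib mult_ac)
  qed
  have "e n * S \<le> (\<Sum>k<m. e k * (cmod (d k))\<^sup>2)"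
    unfolding S_def sum_distrib_left using dec
    by (intro sum_mono) (auto simp: d_def intro!: mult_right_mono)
  also have "\<dots> = (\<Sum>i<N. (cmod ((\<Delta> *\<^sub>v w) $ i))\<^sup>2)"
    using orthogonal_columns_norm[OF XP XPe, of d] zi by simp
  also have "\<dots> \<le> (\<Sum>i<N. m * (max_norm \<Delta>)\<^sup>2 * S)" using zb by (intro sum_mono) auto
  also have "\<dots> = (real N * real m * (max_norm \<Delta>)\<^sup>2) * S" by (simp add: mult_ac)
  finally show ?thesis using S by simp
qed

text \<open>The trace is invariant under cyclic permutation, and \<open>P'P = 1\<close>.\<close>
lemma trace_orthonormal_conjugate:
  fixes P :: "real mat"
  assumes P: "P \<in> carrier_mat m r" "P\<^sup>T * P = 1\<^sub>m r"
  shows "(\<Sum>j<m. (P * mat_diag r e * P\<^sup>T) $$ (j, j)) = (\<Sum>k<r. e k)"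
proof -
  have "(\<Sum>j<m. (P * mat_diag r e * P\<^sup>T) $$ (j, j)) =
      (\<Sum>j<m. \<Sum>k<r. e k * (P $$ (j, k) * P $$ (j, k)))"
    using P by (simp add: mat_diag_mult_right[OF P(1)] scalar_prod_def atLeast0LessThan mult_ac)
  also have "\<dots> = (\<Sum>k<r. e k * (\<Sum>j<m. P $$ (j, k) * P $$ (j, k)))"
    by (subst sum.swap) (simp add: sum_distrib_left)
  also have "\<dots> = (\<Sum>k<r. e k)"
  proof (intro sum.cong refl)
    fix k assume k: "k \<in> {..<r}"
    have "(\<Sum>j<m. P $$ (j, k) * P $$ (j, k)) = (P\<^sup>T * P) $$ (k, k)"
      using k P(1) by (simp add: scalar_prod_def atLeast0LessThan)
    then show "e k * (\<Sum>j<m. P $$ (j, k) * P $$ (j, k)) = e k" using k P(2) by simp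
  qed
  finally show ?thesis .
qed

text \<open>The scaling in the definition of \<open>T\<close> cancels, so that \<open>T T' X = X Q\<close> for the projection
\<open>Q = V\<^sub>p V\<^sub>p'\<close>. As \<open>V\<^sub>p\<close> consists of eigenvectors of \<open>X'X\<close>, the residual \<open>Z = X - X Q\<close> satisfies
\<open>Z'Z = X'X - V\<^sub>p \<Sigma>\<^sub>p V\<^sub>p'\<close>. Its trace, the sum of the squared entries of \<open>Z\<close>, is the sum of the
eigenvalues from position \<open>n\<close> on, each at most the one at position \<open>n\<close>, which the preceding
estimate bounds. The trace depends on the eigenvalues only, whichever orthonormal eigenvectors are chosen.\<close>
lemma snapshot_POD_residual:
  fixes X T :: "real mat" and Y \<alpha> \<Delta> :: "complex mat"
  assumes X: "X \<in> carrier_mat N m" and pod: "snapshot_POD n X T"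
    and Y: "Y \<in> carrier_mat N n" and \<alpha>: "\<alpha> \<in> carrier_mat n m" and \<Delta>: "\<Delta> \<in> carrier_mat N m"
    and split: "cmat X = Y * \<alpha> + \<Delta>"
  shows "T \<in> carrier_mat N n" "T\<^sup>T * T = 1\<^sub>m n"
    and "max_norm (cmat (X - T * T\<^sup>T * X)) \<le> real m * real N * max_norm \<Delta>"
proof -
  let ?G = "X\<^sup>T * X" and ?\<eta> = "max_norm \<Delta>"
  from pod X obtain es Vp where cp: "char_poly ?G = (\<Prod>e \<leftarrow> es. [:- e, 1:])"
    and dec: "sorted_wrt (\<ge>) es" and nle: "n \<le> length es" and nz: "\<And>i. i < n \<Longrightarrow> es ! i \<noteq> 0"
    and Vp: "Vp \<in> carrier_mat m n" and VV: "Vp\<^sup>T * Vp = 1\<^sub>m n"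
    and GV: "?G * Vp = Vp * mat_diag n (\<lambda>i. es ! i)"
    and T: "T = X * Vp * mat_diag n (\<lambda>i. (es ! i) powr (- 1 / 2))"
    unfolding snapshot_POD_def by auto
  let ?S = "mat_diag n (\<lambda>i. es ! i)" and ?R = "mat_diag n (\<lambda>i. (es ! i) powr (- 1 / 2))"
  have G: "?G \<in> carrier_mat m m" using X by simp
  have Gsym: "?G\<^sup>T = ?G" using X by (simp add: transpose_mult[of _ m N _ m])
  have Xt: "X\<^sup>T \<in> carrier_mat m N" and Vt: "Vp\<^sup>T \<in> carrier_mat n m" using X Vp by auto
  have S: "?S \<in> carrier_mat n n" and R: "?R \<in> carrier_mat n n" by auto
  have XV: "X * Vp \<in> carrier_mat N n" using X Vp by simp
  have VGV: "(X * Vp)\<^sup>T * (X * Vp) = ?S"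
  proof -
    have "(X * Vp)\<^sup>T * (X * Vp) = Vp\<^sup>T * (?G * Vp)"
      using X Vp by (simp add: transpose_mult[OF X Vp] assoc_mult_mat[of _ n m _ N _ n]
          assoc_mult_mat[of _ m N _ m _ n])
    also have "\<dots> = (Vp\<^sup>T * Vp) * ?S" unfolding GV using Vp by (simp add: assoc_mult_mat[of _ n m _ n _ n])
    finally show ?thesis using VV S by (simp add: left_mult_one_mat[OF S])
  qed
  have pos: "es ! i > 0" if i: "i < n" for i
  proof -
    have "es ! i = ((X * Vp)\<^sup>T * (X * Vp)) $$ (i, i)" unfolding VGV using i by (simp add: mat_diag_def)
    also have "\<dots> = (\<Sum>k<N. ((X * Vp) $$ (k, i))\<^sup>2)"
      unfolding gram_entry[OF XV i i] by (simp add: power2_eq_square)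
    also have "\<dots> \<ge> 0" by (intro sum_nonneg) auto
    finally show ?thesis using nz[OF i] by linarith
  qed
  have powr_sq: "x powr (- 1 / 2) * x powr (- 1 / 2) * x = 1" if "x > 0" for x :: real
  proof -
    have "x powr (- 1 / 2) * x powr (- 1 / 2) = x powr (- 1 / 2 + - 1 / 2)" by (rule powr_add[symmetric])
    then show ?thesis using that by (simp add: powr_minus)
  qed
  have RRS: "?R * ?R * ?S = 1\<^sub>m n" "?R * (?S * ?R) = 1\<^sub>m n"
    unfolding mat_diag_diag using powr_sq pos by (auto simp: mat_diag_def mult_ac)
  show Tc: "T \<in> carrier_mat N n" unfolding T using XV R by simp
  have "?R\<^sup>T = ?R" by (auto simp: mat_diag_def)
  then have Tt: "T\<^sup>T = ?R * (X * Vp)\<^sup>T"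
    unfolding T using transpose_mult[OF XV R] by simp
  have XVt: "(X * Vp)\<^sup>T \<in> carrier_mat n N" using XV by simp
  have "T\<^sup>T * T = ?R * ((X * Vp)\<^sup>T * (X * Vp) * ?R)"
    unfolding Tt unfolding T
    using assoc_mult_mat[OF R XVt mult_carrier_mat[OF XV R]] assoc_mult_mat[OF XVt XV R] by simp
  then show TT: "T\<^sup>T * T = 1\<^sub>m n" unfolding VGV using RRS(2) by simp
  define Q where "Q = Vp * Vp\<^sup>T"
  have Q: "Q \<in> carrier_mat m m" using Vp by (simp add: Q_def)
  have VtG: "Vp\<^sup>T * ?G = ?S * Vp\<^sup>T"
  proof -
    have "Vp\<^sup>T * ?G = (?G * Vp)\<^sup>T" using transpose_mult[OF G Vp] Gsym by simp
    also have "\<dots> = ?S\<^sup>T * Vp\<^sup>T" unfolding GV by (rule transpose_mult[OF Vp S])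
    also have "?S\<^sup>T = ?S" by (auto simp: mat_diag_def)
    finally show ?thesis .
  qed
  have proj: "T * T\<^sup>T * X = X * Q"
  proof -
    have "T * T\<^sup>T * X = T * (T\<^sup>T * X)" using Tc X by (intro assoc_mult_mat[of _ N n _ N _ m]) auto
    also have "T\<^sup>T * X = ?R * (Vp\<^sup>T * ?G)"
      unfolding Tt transpose_mult[OF X Vp]
      using assoc_mult_mat[OF R mult_carrier_mat[OF Vt Xt] X] assoc_mult_mat[OF Vt Xt X] by simp
    also have "T * \<dots> = X * Vp * (?R * (?R * (?S * Vp\<^sup>T)))"
      unfolding VtG T
      using assoc_mult_mat[OF XV R mult_carrier_mat[OF R mult_carrier_mat[OF S Vt]]] by simp
    also have "?R * (?R * (?S * Vp\<^sup>T)) = (?R * ?R * ?S) * Vp\<^sup>T"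
      using assoc_mult_mat[OF mult_carrier_mat[OF R R] S Vt]
        assoc_mult_mat[OF R R mult_carrier_mat[OF S Vt]] by simp
    also have "\<dots> = Vp\<^sup>T" unfolding RRS(1) by (rule left_mult_one_mat[OF Vt])
    finally show ?thesis using assoc_mult_mat[OF X Vp Vt] by (simp add: Q_def)
  qed
  define Z where "Z = X - X * Q"
  have Z: "Z \<in> carrier_mat N m" using X Q by (simp add: Z_def minus_carrier_mat)
  have Qt: "Q\<^sup>T = Q" unfolding Q_def using transpose_mult[OF Vp Vt] by simp
  have GQ: "?G * Q = Vp * ?S * Vp\<^sup>T"
    unfolding Q_def using assoc_mult_mat[OF G Vp Vt] GV by simp
  have QG: "Q * ?G = Vp * ?S * Vp\<^sup>T"
    unfolding Q_def using assoc_mult_mat[OF Vp Vt G] VtG assoc_mult_mat[OF Vp S Vt] by simp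
  have QGQ: "Q * ?G * Q = Vp * ?S * Vp\<^sup>T"
  proof -
    have "Q * ?G * Q = Vp * ?S * (Vp\<^sup>T * Q)"
      unfolding QG by (rule assoc_mult_mat[OF mult_carrier_mat[OF Vp S] Vt Q])
    also have "Vp\<^sup>T * Q = (Vp\<^sup>T * Vp) * Vp\<^sup>T" unfolding Q_def using assoc_mult_mat[OF Vt Vp Vt] by simp
    also have "\<dots> = Vp\<^sup>T" unfolding VV by (rule left_mult_one_mat[OF Vt])
    finally show ?thesis .
  qed
  let ?H = "Vp * ?S * Vp\<^sup>T"
  have H: "?H \<in> carrier_mat m m" by (rule mult_carrier_mat[OF mult_carrier_mat[OF Vp S] Vt])
  have ZZ: "Z\<^sup>T * Z = ?G - ?H"
  proof -
    have XQ: "X * Q \<in> carrier_mat N m" and XQt: "(X * Q)\<^sup>T \<in> carrier_mat m N" using X Q by auto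
    have "Z\<^sup>T = X\<^sup>T - (X * Q)\<^sup>T"
      unfolding Z_def by (rule transpose_minus[OF X XQ])
    then have "Z\<^sup>T * Z = (X\<^sup>T - (X * Q)\<^sup>T) * X - (X\<^sup>T - (X * Q)\<^sup>T) * (X * Q)"
      using mult_minus_distrib_mat[OF minus_carrier_mat[OF XQt] X XQ] by (simp add: Z_def)
    also have "\<dots> = (?G - (X * Q)\<^sup>T * X) - (X\<^sup>T * (X * Q) - (X * Q)\<^sup>T * (X * Q))"
      unfolding minus_mult_distrib_mat[OF Xt XQt X] minus_mult_distrib_mat[OF Xt XQt XQ] ..
    also have "(X * Q)\<^sup>T * X = ?H"
      using transpose_mult[OF X Q] Qt assoc_mult_mat[OF Q Xt X] QG by simp
    also have "X\<^sup>T * (X * Q) = ?H"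
      using assoc_mult_mat[OF Xt X Q] GQ by simp
    also have "(X * Q)\<^sup>T * (X * Q) = ?H"
      using transpose_mult[OF X Q] Qt assoc_mult_mat[OF Q Xt XQ] assoc_mult_mat[OF Xt X Q]
        assoc_mult_mat[OF Q G Q] QGQ by simp
    finally show ?thesis using G H by (intro eq_matI) auto
  qed
  from symmetric_orthogonal_diagonalization[OF G Gsym cp] obtain P where len: "length es = m"
    and P: "P \<in> carrier_mat m m" "P\<^sup>T * P = 1\<^sub>m m" and GP: "?G * P = P * mat_diag m (\<lambda>i. es ! i)"
    by blast
  let ?D = "mat_diag m (\<lambda>i. es ! i)"
  have Pt: "P\<^sup>T \<in> carrier_mat m m" using P by simp
  have "P * P\<^sup>T = 1\<^sub>m m" by (rule mat_mult_left_right_inverse[OF Pt P(1,2)])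
  then have GD: "?G = P * ?D * P\<^sup>T"
    using assoc_mult_mat[OF G P(1) Pt] GP right_mult_one_mat[OF G] by simp
  have sq: "(\<Sum>j<m. \<Sum>i<N. (Z $$ (i, j))\<^sup>2) = (\<Sum>k<m. es ! k) - (\<Sum>k<n. es ! k)"
  proof -
    have "(\<Sum>j<m. \<Sum>i<N. (Z $$ (i, j))\<^sup>2) = (\<Sum>j<m. (Z\<^sup>T * Z) $$ (j, j))"
      using Z by (simp add: scalar_prod_def atLeast0LessThan power2_eq_square)
    also have "\<dots> = (\<Sum>j<m. ?G $$ (j, j)) - (\<Sum>j<m. ?H $$ (j, j))"
      unfolding ZZ using G H by (simp add: sum_subtractf del: index_mult_mat)
    also have "(\<Sum>j<m. ?H $$ (j, j)) = (\<Sum>k<n. es ! k)"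
      by (rule trace_orthonormal_conjugate[OF Vp VV])
    also have "(\<Sum>j<m. ?G $$ (j, j)) = (\<Sum>k<m. es ! k)"
      unfolding GD by (rule trace_orthonormal_conjugate[OF P])
    finally show ?thesis .
  qed
  have "(\<Sum>k<m. es ! k) - (\<Sum>k<n. es ! k) = (\<Sum>k=n..<m. es ! k)"
    using nle len sum.atLeastLessThan_concat[of 0 n m "\<lambda>k. es ! k"]
    by (simp add: atLeast0LessThan)
  also have "\<dots> \<le> (real m * real N * ?\<eta>)\<^sup>2"
  proof (cases "n < m")
    case False
    then show ?thesis by simp
  next
    case True
    have mono: "es ! j \<le> es ! i" if "i \<le> j" "j < m" for i j
      using sorted_wrt_nth_less[OF dec, of i j] that len by (cases "i = j") auto
    have en: "es ! n \<le> real N * real m * ?\<eta>\<^sup>2"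
      using mono True by (intro eigenvalue_beyond_rank_le[OF X P GP Y \<alpha> \<Delta> split True]) auto
    have "(\<Sum>k=n..<m. es ! k) \<le> (\<Sum>k=n..<m. real N * real m * ?\<eta>\<^sup>2)"
      using mono en by (intro sum_mono order_trans[OF _ en]) auto
    also have "\<dots> \<le> real m * (real N * real m * ?\<eta>\<^sup>2)"
      by (simp del: of_nat_diff) (intro mult_right_mono, auto)
    also have "\<dots> \<le> real N * (real m * (real N * real m * ?\<eta>\<^sup>2))"
    proof (cases "N = 0")
      case False
      then have "1 \<le> real N" by simp
      then show ?thesis by (metis mult_1 mult_right_mono mult_nonneg_nonneg of_nat_0_le_iff zero_le_power2)
    qed simp
    finally show ?thesis by (simp add: power_mult_distrib power2_eq_square mult_ac)
  qed
  finally have tail: "(\<Sum>k<m. es ! k) - (\<Sum>k<n. es ! k) \<le> (real m * real N * ?\<eta>)\<^sup>2" .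
  have "\<bar>Z $$ (i, j)\<bar> \<le> real m * real N * ?\<eta>" if ij: "i < N" "j < m" for i j
  proof -
    have "(Z $$ (i, j))\<^sup>2 \<le> (\<Sum>i<N. (Z $$ (i, j))\<^sup>2)"
      using ij by (intro member_le_sum[of i "{..<N}" "\<lambda>i. (Z $$ (i, j))\<^sup>2"]) auto
    also have "\<dots> \<le> (\<Sum>j<m. \<Sum>i<N. (Z $$ (i, j))\<^sup>2)"
      using ij by (intro member_le_sum[of j "{..<m}" "\<lambda>j. \<Sum>i<N. (Z $$ (i, j))\<^sup>2"] sum_nonneg) auto
    finally have "(Z $$ (i, j))\<^sup>2 \<le> (real m * real N * ?\<eta>)\<^sup>2" using tail sq by linarith
    then have "\<bar>Z $$ (i, j)\<bar> \<le> \<bar>real m * real N * ?\<eta>\<bar>" by (simp only: abs_le_square_iff)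
    then show ?thesis by (simp add: abs_mult)
  qed
  then show "max_norm (cmat (X - T * T\<^sup>T * X)) \<le> real m * real N * ?\<eta>"
    unfolding proj Z_def[symmetric] using Z by (intro max_norm_leI) auto
qed

section \<open>The reduced model recovers the active eigenpairs\<close>

lemma join_cols_entry:
  assumes "V \<in> carrier_mat N n" "V' \<in> carrier_mat N n'" "i < N" "j < n + n'"
  shows "join_cols V V' $$ (i, j) = (if j < n then V $$ (i, j) else V' $$ (i, j - n))"
  using assms by (auto simp: join_cols_def mat_of_cols_index nth_append)

text \<open>Everything that concerns \<open>V\<close> alone: the first \<open>n\<close> rows of the inverse of the whole eigenvector matrix
are a left inverse of \<open>V\<close>, and distinctness passes from the whole spectrum to the eigenvalues that
belong to \<open>V\<close>.\<close>
lemma eigendecomposition_leading_block: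
  assumes M: "M \<in> carrier_mat N N" and n: "n \<le> N"
    and V: "V \<in> carrier_mat N n" and V': "V' \<in> carrier_mat N (N - n)"
    and \<Lambda>: "\<Lambda> \<in> carrier_mat n n" and \<Lambda>': "\<Lambda>' \<in> carrier_mat (N - n) (N - n)"
    and eig: "eigendecomposition M (join_cols V V') (diag_block_mat [\<Lambda>, \<Lambda>'])"
    and distinct: "distinct_eigenvalues M"
  obtains L where "L \<in> carrier_mat n N" "L * V = 1\<^sub>m n"
    and "\<Lambda> = mat_diag n (\<lambda>i. \<Lambda> $$ (i, i))"
    and "M * V = V * mat_diag n (\<lambda>i. \<Lambda> $$ (i, i))"
    and "inj_on (\<lambda>i. \<Lambda> $$ (i, i)) {..<n}"
proof -
  define J where "J = join_cols V V'"
  define D where "D = diag_block_mat [\<Lambda>, \<Lambda>']"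
  have D4: "D = four_block_mat \<Lambda> (0\<^sub>m n (N - n)) (0\<^sub>m (N - n) n) \<Lambda>'"
    using \<Lambda> \<Lambda>' diag_block_mat_append[of "[\<Lambda>]" "[\<Lambda>']"]
    by (simp add: D_def Let_def del: diag_block_mat.simps)
  from eig M have J: "J \<in> carrier_mat N N" and D: "D \<in> carrier_mat N N" and invJ: "invertible_mat J"
    and diagD: "diagonal_mat D" and MJ: "M * J = J * D"
    by (auto simp: eigendecomposition_def J_def D_def)
  have Jij: "J $$ (i, j) = V $$ (i, j)" if "i < N" "j < n" for i j
    using join_cols_entry[OF V V', of i j] that n by (simp add: J_def)
  have Dij: "D $$ (i, j) = \<Lambda> $$ (i, j)" if "i < n" "j < n" for i j
    using that \<Lambda> \<Lambda>' n by (simp add: D4)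
  have D0: "D $$ (i, j) = 0" if "i < N" "j < N" "i \<noteq> j" for i j
    using diagD D that by (auto simp: diagonal_mat_def)
  obtain B where B: "B \<in> carrier_mat N N" "J * B = 1\<^sub>m N" "B * J = 1\<^sub>m N"
    using invertible_mat_inverse[OF J invJ] by blast
  define L where "L = mat n N (\<lambda>(i, k). B $$ (i, k))"
  have L: "L \<in> carrier_mat n N" by (simp add: L_def)
  have LV: "L * V = 1\<^sub>m n"
  proof (rule eq_matI)
    fix i j assume "i < dim_row (1\<^sub>m n :: complex mat)" "j < dim_col (1\<^sub>m n :: complex mat)"
    then have ij: "i < n" "j < n" by auto
    have "(L * V) $$ (i, j) = (\<Sum>k<N. B $$ (i, k) * J $$ (k, j))"
      unfolding mult_mat_entry[OF L V ij] using ij Jij by (simp add: L_def)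
    also have "\<dots> = (B * J) $$ (i, j)"
      using ij n by (intro mult_mat_entry[OF B(1) J, symmetric]) auto
    finally show "(L * V) $$ (i, j) = 1\<^sub>m n $$ (i, j)" using ij n by (simp add: B(3))
  qed (use L V in auto)
  have \<Lambda>d: "\<Lambda> = mat_diag n (\<lambda>i. \<Lambda> $$ (i, i))"
  proof (rule eq_matI)
    fix i j assume "i < dim_row (mat_diag n (\<lambda>i. \<Lambda> $$ (i, i)))" "j < dim_col (mat_diag n (\<lambda>i. \<Lambda> $$ (i, i)))"
    then have ij: "i < n" "j < n" by (auto simp: mat_diag_def)
    then show "\<Lambda> $$ (i, j) = mat_diag n (\<lambda>i. \<Lambda> $$ (i, i)) $$ (i, j)"
      using D0[of i j] Dij[of i j] n by (auto simp: mat_diag_def)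
  qed (use \<Lambda> in \<open>auto simp: mat_diag_def\<close>)
  have MV: "M * V = V * \<Lambda>"
  proof (rule eq_matI)
    fix i j assume "i < dim_row (V * \<Lambda>)" "j < dim_col (V * \<Lambda>)"
    then have ij: "i < N" "j < n" using V \<Lambda> by auto
    then have jN: "j < N" using n by simp
    have "(M * V) $$ (i, j) = (\<Sum>k<N. M $$ (i, k) * J $$ (k, j))"
      unfolding mult_mat_entry[OF M V ij] using ij Jij by simp
    also have "\<dots> = (M * J) $$ (i, j)" by (rule mult_mat_entry[OF M J ij(1) jN, symmetric])
    also have "\<dots> = (\<Sum>k<N. J $$ (i, k) * D $$ (k, j))"
      unfolding MJ by (rule mult_mat_entry[OF J D ij(1) jN])
    also have "\<dots> = (\<Sum>k<n. V $$ (i, k) * \<Lambda> $$ (k, j))"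
      using ij n D0 Jij Dij by (intro sum.mono_neutral_cong_right) auto
    also have "\<dots> = (V * \<Lambda>) $$ (i, j)" by (rule mult_mat_entry[OF V \<Lambda> ij, symmetric])
    finally show "(M * V) $$ (i, j) = (V * \<Lambda>) $$ (i, j)" .
  qed (use M V \<Lambda> in auto)
  have dD: "distinct (diag_mat D)"
  proof -
    have "similar_mat_wit M D J B"
    proof (rule similar_mat_witI[of _ _ N])
      have "J * D * B = M * (J * B)" unfolding MJ[symmetric] by (rule assoc_mult_mat[OF M J B(1)])
      then show "M = J * D * B" using B(2) right_mult_one_mat[OF M] by simp
    qed (use M D J B in auto)
    then have "char_poly M = char_poly D" by (intro char_poly_similar) (auto simp: similar_mat_def)
    also have "upper_triangular D" using D0 D by (auto simp: upper_triangular_def)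
    then have "char_poly D = (\<Prod>a\<leftarrow>diag_mat D. [:- a, 1:])" by (rule char_poly_upper_triangular[OF D])
    finally have "spectrum M = set (diag_mat D)"
      by (auto simp: spectrum_root_char_poly[OF M] poly_prod_list)
    then have "card (set (diag_mat D)) = length (diag_mat D)"
      using distinct M D by (simp add: distinct_eigenvalues_def diag_mat_def)
    then show ?thesis by (rule card_distinct)
  qed
  have inj: "inj_on (\<lambda>i. \<Lambda> $$ (i, i)) {..<n}"
  proof (rule inj_onI)
    fix i j assume ij: "i \<in> {..<n}" "j \<in> {..<n}" and eq: "\<Lambda> $$ (i, i) = \<Lambda> $$ (j, j)"
    then have "diag_mat D ! i = diag_mat D ! j" using Dij n D by (simp add: diag_mat_def)
    moreover have "length (diag_mat D) = N" using D by (simp add: diag_mat_def)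
    ultimately show "i = j" using nth_eq_iff_index_eq[OF dD, of i j] ij n by auto
  qed
  show ?thesis using that[OF L LV \<Lambda>d _ inj] MV \<Lambda>d by simp
qed

text \<open>The projection \<open>T T'\<close> nearly reproduces \<open>X\<close>, hence also \<open>V \<alpha> = X - \<Delta>\<close>; multiplication by the right
inverse \<open>R\<close> of \<open>\<alpha>\<close> gives the same for \<open>V\<close>. The entries of \<open>T\<close> are at most 1 because its columns have
length 1.\<close>
lemma POD_captures_dominant_subspace:
  fixes V \<alpha> R :: "complex mat"
  assumes V: "V \<in> carrier_mat N n" and \<alpha>: "\<alpha> \<in> carrier_mat n m"
    and R: "R \<in> carrier_mat m n" and \<alpha>R: "\<alpha> * R = 1\<^sub>m n"
    and X: "X \<in> carrier_mat N m" and pod: "snapshot_POD n X T"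
    and \<Delta>: "\<Delta> \<in> carrier_mat N m" and split: "cmat X = V * \<alpha> + \<Delta>"
  shows "max_norm (cmat T) \<le> 1" "max_norm (cmat T\<^sup>T) \<le> 1"
    and "max_norm (V - cmat T * (cmat T\<^sup>T * V)) \<le>
      real m * (real m * real N + real N * real n + 1) * max_norm R * max_norm \<Delta>"
proof -
  let ?T = "cmat T" and ?T' = "cmat T\<^sup>T" and ?\<eta> = "max_norm \<Delta>"
  note pod_facts = snapshot_POD_residual[OF X pod V \<alpha> \<Delta> split]
  have T: "T \<in> carrier_mat N n" by (rule pod_facts(1))
  have entry: "\<bar>T $$ (i, j)\<bar> \<le> 1" if "i < N" "j < n" for i j
  proof -
    have "(T $$ (i, j))\<^sup>2 \<le> (\<Sum>k<N. (T $$ (k, j))\<^sup>2)"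
      using that by (intro member_le_sum[of i "{..<N}" "\<lambda>k. (T $$ (k, j))\<^sup>2"]) auto
    also have "\<dots> = (T\<^sup>T * T) $$ (j, j)"
      unfolding gram_entry[OF T that(2) that(2)] by (simp add: power2_eq_square)
    also have "\<dots> = 1" using that by (simp add: pod_facts(2))
    finally show ?thesis by (simp add: abs_square_le_1)
  qed
  show nT: "max_norm ?T \<le> 1" using T entry by (intro max_norm_leI) auto
  show nT': "max_norm ?T' \<le> 1" using T entry by (intro max_norm_leI) auto
  have cT: "?T \<in> carrier_mat N n" and cT': "?T' \<in> carrier_mat n N" and cX: "cmat X \<in> carrier_mat N m"
    using T X by auto
  have V\<alpha>: "V * \<alpha> \<in> carrier_mat N m" using V \<alpha> by simp
  define Q where "Q = ?T * ?T'"
  have Q: "Q \<in> carrier_mat N N" using cT cT' by (simp add: Q_def)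
  have QX: "Q * cmat X \<in> carrier_mat N m" and Q\<Delta>: "Q * \<Delta> \<in> carrier_mat N m" using Q cX \<Delta> by auto
  have nQ: "max_norm Q \<le> n" unfolding Q_def using max_norm_mult_mono[OF cT cT' nT nT'] by simp
  have nQ\<Delta>: "max_norm (Q * \<Delta>) \<le> real N * real n * ?\<eta>" by (rule max_norm_mult_mono[OF Q \<Delta> nQ order_refl])
  have real_part: "cmat (X - T * T\<^sup>T * X) = cmat X - Q * cmat X"
  proof -
    have "cmat (T * T\<^sup>T * X) = Q * cmat X"
      unfolding Q_def using T X by (intro cmat_mult3[of _ N n _ N _ m]) auto
    moreover have "cmat (X - T * T\<^sup>T * X) = cmat X - cmat (T * T\<^sup>T * X)"
      using T X by (intro eq_matI) (auto simp del: index_mult_mat(1))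
    ultimately show ?thesis by simp
  qed
  define K where "K = (cmat X - Q * cmat X) - (\<Delta> - Q * \<Delta>)"
  have K: "K \<in> carrier_mat N m" using QX Q\<Delta> by (simp add: K_def minus_carrier_mat)
  have "max_norm K \<le> (real m * real N * ?\<eta>) + (?\<eta> + real N * real n * ?\<eta>)"
    unfolding K_def
    using max_norm_minus[OF minus_carrier_mat[OF QX] minus_carrier_mat[OF Q\<Delta>], of "cmat X" \<Delta>]
      max_norm_minus[OF \<Delta> Q\<Delta>] nQ\<Delta> pod_facts(3) unfolding real_part by linarith
  also have "\<dots> = (real m * real N + real N * real n + 1) * ?\<eta>" by (simp add: algebra_simps)
  finally have nK: "max_norm K \<le> (real m * real N + real N * real n + 1) * ?\<eta>" .
  have KV: "K = V * \<alpha> - Q * (V * \<alpha>)"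
  proof -
    have "Q * cmat X = Q * (V * \<alpha>) + Q * \<Delta>"
      unfolding split by (rule mult_add_distrib_mat[OF Q V\<alpha> \<Delta>])
    then show ?thesis unfolding K_def split using V\<alpha> Q \<Delta>
      by (intro eq_matI) (auto simp del: index_mult_mat(1))
  qed
  have "K * R = V * \<alpha> * R - Q * (V * \<alpha>) * R"
    unfolding KV by (rule minus_mult_distrib_mat[OF V\<alpha> mult_carrier_mat[OF Q V\<alpha>] R])
  also have "V * \<alpha> * R = V" using assoc_mult_mat[OF V \<alpha> R] \<alpha>R right_mult_one_mat[OF V] by simp
  also have "Q * (V * \<alpha>) * R = Q * V"
    using assoc_mult_mat[OF Q V\<alpha> R] assoc_mult_mat[OF V \<alpha> R] \<alpha>R right_mult_one_mat[OF V] by simp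
  also have "Q * V = ?T * (?T' * V)" unfolding Q_def by (rule assoc_mult_mat[OF cT cT' V])
  finally have "V - ?T * (?T' * V) = K * R" ..
  then have "max_norm (V - ?T * (?T' * V)) \<le> real m * ((real m * real N + real N * real n + 1) * ?\<eta>) * max_norm R"
    using max_norm_mult_mono[OF K R nK order_refl] by simp
  then show "max_norm (V - ?T * (?T' * V)) \<le> real m * (real m * real N + real N * real n + 1) * max_norm R * ?\<eta>"
    by (simp add: mult_ac)
qed

theorem proposition2:
  fixes N n p M1 :: nat
    and A :: "real mat"
    and V_N V_E Lam_hat Lam_E alpha_N :: "complex mat"
    and C :: real
    and \<nu> :: "complex mat \<Rightarrow> real"
  assumes norm: "matrix_norm \<nu>"
    and A: "A \<in> carrier_mat N N"
    and stable: "stable_mat (cmat A)"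
    and distinct: "distinct_eigenvalues (cmat A)"
    and n: "n \<le> N"
    and V_N: "V_N \<in> carrier_mat N n"
    and V_E: "V_E \<in> carrier_mat N (N - n)"
    and Lam_hat: "Lam_hat \<in> carrier_mat n n"
    and Lam_E: "Lam_E \<in> carrier_mat (N - n) (N - n)"
    and V: "eigendecomposition (cmat A) (join_cols V_N V_E) (diag_block_mat [Lam_hat, Lam_E])"
    and alpha_N: "alpha_N \<in> carrier_mat n (p * M1)"
    and rank: "vec_space.rank N (V_N * alpha_N) = n"
  shows "\<exists>\<epsilon>0 > 0. \<exists>k1 > 0. \<exists>k2 > 0.
    \<forall>\<epsilon> B ts delta_alpha X T_r A_red P_r Lam_r V_r.
      0 < \<epsilon> \<longrightarrow> \<epsilon> \<le> \<epsilon>0 \<longrightarrow>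
      B \<in> carrier_mat N p \<longrightarrow> length ts = M1 \<longrightarrow>
      X = snapshot_matrix A B ts \<longrightarrow>
      delta_alpha \<in> carrier_mat (N - n) (p * M1) \<longrightarrow>
      cmat X = V_N * alpha_N + V_E * delta_alpha \<longrightarrow>
      \<nu> delta_alpha \<le> C * \<epsilon> \<longrightarrow>
      snapshot_POD n X T_r \<longrightarrow>
      A_red = T_r\<^sup>T * A * T_r \<longrightarrow>
      distinct_eigenvalues (cmat A_red) \<longrightarrow>
      eigendecomposition (cmat A_red) P_r Lam_r \<longrightarrow>
      V_r = cmat T_r * P_r \<longrightarrow>
      (\<exists>\<pi> c. \<pi> permutes {..<n} \<and> (\<forall>j<n. c j \<noteq> 0) \<and>
        \<nu> (mat n n (\<lambda>(i, j). Lam_r $$ (\<pi> i, \<pi> j)) - Lam_hat) \<le> k1 * \<epsilon> \<and>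
        \<nu> (mat N n (\<lambda>(i, j). c j * V_r $$ (i, \<pi> j)) - V_N) \<le> k2 * \<epsilon>)"
proof -
  let ?m = "p * M1"
  let ?l = "\<lambda>i. Lam_hat $$ (i, i)"
  have cA: "cmat A \<in> carrier_mat N N" using A by simp
  obtain L where L: "L \<in> carrier_mat n N" "L * V_N = 1\<^sub>m n"
    and Lam: "Lam_hat = mat_diag n ?l" and AV: "cmat A * V_N = V_N * mat_diag n ?l"
    and inj: "inj_on ?l {..<n}"
    by (rule eigendecomposition_leading_block[OF cA n V_N V_E Lam_hat Lam_E V distinct])
  obtain R where R: "R \<in> carrier_mat ?m n" "alpha_N * R = 1\<^sub>m n"
    by (rule full_rank_product_right_inverse[OF V_N alpha_N rank])
  from invariant_subspace_perturbation[OF cA V_N L AV inj]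
  obtain \<eta>0 K where \<eta>0: "\<eta>0 > 0" and K: "K > 0"
    and pert: "\<And>T T' P D \<eta>. T \<in> carrier_mat N n \<Longrightarrow> T' \<in> carrier_mat n N \<Longrightarrow>
      max_norm T \<le> 1 \<Longrightarrow> max_norm T' \<le> 1 \<Longrightarrow>
      max_norm (V_N - T * (T' * V_N)) \<le> \<eta> \<Longrightarrow> \<eta> \<le> \<eta>0 \<Longrightarrow>
      eigendecomposition (T' * cmat A * T) P D \<Longrightarrow>
      \<exists>\<pi> c. \<pi> permutes {..<n} \<and> (\<forall>j<n. c j \<noteq> 0) \<and>
        max_norm (mat n n (\<lambda>(i, j). D $$ (\<pi> i, \<pi> j)) - mat_diag n ?l) \<le> K * \<eta> \<and>
        max_norm (mat N n (\<lambda>(i, j). c j * (T * P) $$ (i, \<pi> j)) - V_N) \<le> K * \<eta>"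
    by blast
  obtain Ka where Ka: "Ka > 0" "\<And>M. M \<in> carrier_mat (N - n) ?m \<Longrightarrow> max_norm M \<le> Ka * \<nu> M"
    using max_norm_le_matrix_norm[OF norm] by blast
  obtain K1 where K1: "K1 > 0" "\<And>M. M \<in> carrier_mat n n \<Longrightarrow> \<nu> M \<le> K1 * max_norm M"
    using matrix_norm_le_max_norm[OF norm] by blast
  obtain K2 where K2: "K2 > 0" "\<And>M. M \<in> carrier_mat N n \<Longrightarrow> \<nu> M \<le> K2 * max_norm M"
    using matrix_norm_le_max_norm[OF norm] by blast
  \<comment> \<open>\<open>q \<epsilon>\<close> bounds the distance of \<open>V_N\<close> from its projection; adding 1 makes \<open>q\<close> positive\<close>
  define q where "q = real ?m * (real ?m * real N + real N * real n + 1) * max_norm R *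
      (real (N - n) * max_norm V_E * (Ka * \<bar>C\<bar>)) + 1"
  have q: "q > 0" unfolding q_def using Ka(1) by (intro add_nonneg_pos mult_nonneg_nonneg) auto
  show ?thesis
  proof (rule exI[of _ "\<eta>0 / q"], rule conjI[rotated],
      rule exI[of _ "K1 * (K * q)"], rule conjI[rotated],
      rule exI[of _ "K2 * (K * q)"], rule conjI[rotated], intro allI impI)
    show "0 < \<eta>0 / q" using \<eta>0 q by simp
    show "0 < K1 * (K * q)" using K1 K q by simp
    show "0 < K2 * (K * q)" using K2 K q by simp
    fix \<epsilon> :: real and B :: "real mat" and ts :: "nat list" and delta_alpha :: "complex mat"
      and X T_r A_red :: "real mat" and P_r Lam_r V_r :: "complex mat"
    assume \<epsilon>: "0 < \<epsilon>" "\<epsilon> \<le> \<eta>0 / q" and B: "B \<in> carrier_mat N p" and ts: "length ts = M1"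
      and X: "X = snapshot_matrix A B ts" and da: "delta_alpha \<in> carrier_mat (N - n) ?m"
      and split: "cmat X = V_N * alpha_N + V_E * delta_alpha" and small: "\<nu> delta_alpha \<le> C * \<epsilon>"
      and pod: "snapshot_POD n X T_r" and A_red: "A_red = T_r\<^sup>T * A * T_r"
      and eig: "eigendecomposition (cmat A_red) P_r Lam_r" and V_r: "V_r = cmat T_r * P_r"
    have \<Delta>: "V_E * delta_alpha \<in> carrier_mat N ?m" using V_E da by simp
    have "V_N * alpha_N + V_E * delta_alpha \<in> carrier_mat N ?m" using \<Delta> by simp
    then have Xc: "X \<in> carrier_mat N ?m" unfolding split[symmetric] by simp
    have "Ka * \<nu> delta_alpha \<le> Ka * (\<bar>C\<bar> * \<epsilon>)"
      using small Ka(1) \<epsilon>(1) by (intro mult_left_mono order_trans[OF small] mult_right_mono) auto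
    then have "max_norm delta_alpha \<le> Ka * \<bar>C\<bar> * \<epsilon>" using Ka(2)[OF da] by simp
    from max_norm_mult_mono[OF V_E da order_refl this]
    have n\<Delta>: "max_norm (V_E * delta_alpha) \<le> (real (N - n) * max_norm V_E * (Ka * \<bar>C\<bar>)) * \<epsilon>"
      by (simp add: mult_ac)
    note captured = POD_captures_dominant_subspace[OF V_N alpha_N R Xc pod \<Delta> split]
    have T: "T_r \<in> carrier_mat N n" by (rule snapshot_POD_residual(1)[OF Xc pod V_N alpha_N \<Delta> split])
    have "max_norm (V_N - cmat T_r * (cmat T_r\<^sup>T * V_N)) \<le>
        real ?m * (real ?m * real N + real N * real n + 1) * max_norm R *
          ((real (N - n) * max_norm V_E * (Ka * \<bar>C\<bar>)) * \<epsilon>)"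
      by (rule order_trans[OF captured(3) mult_left_mono[OF n\<Delta>]]) simp
    also have "\<dots> \<le> q * \<epsilon>" using \<epsilon>(1) by (simp add: q_def algebra_simps)
    finally have res: "max_norm (V_N - cmat T_r * (cmat T_r\<^sup>T * V_N)) \<le> q * \<epsilon>" .
    have q\<epsilon>: "q * \<epsilon> \<le> \<eta>0" using \<epsilon>(2) q by (simp add: field_simps)
    have "cmat A_red = cmat T_r\<^sup>T * cmat A * cmat T_r"
      unfolding A_red using T A by (intro cmat_mult3[of _ n N _ N _ n]) auto
    with eig have eig': "eigendecomposition (cmat T_r\<^sup>T * cmat A * cmat T_r) P_r Lam_r" by simp
    obtain \<pi> c where \<pi>: "\<pi> permutes {..<n}" and c: "\<forall>j<n. c j \<noteq> 0"
      and b1: "max_norm (mat n n (\<lambda>(i, j). Lam_r $$ (\<pi> i, \<pi> j)) - Lam_hat) \<le> K * (q * \<epsilon>)"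
      and b2: "max_norm (mat N n (\<lambda>(i, j). c j * V_r $$ (i, \<pi> j)) - V_N) \<le> K * (q * \<epsilon>)"
      using pert[OF _ _ captured(1,2) res q\<epsilon> eig'] T unfolding V_r Lam[symmetric] by auto
    have "\<nu> (mat n n (\<lambda>(i, j). Lam_r $$ (\<pi> i, \<pi> j)) - Lam_hat) \<le> K1 * (K * q) * \<epsilon>"
      using order_trans[OF K1(2)[OF minus_carrier_mat[OF Lam_hat]]
        mult_left_mono[OF b1 less_imp_le[OF K1(1)]]] by (simp add: mult.assoc)
    moreover have "\<nu> (mat N n (\<lambda>(i, j). c j * V_r $$ (i, \<pi> j)) - V_N) \<le> K2 * (K * q) * \<epsilon>"
      using order_trans[OF K2(2)[OF minus_carrier_mat[OF V_N]]
        mult_left_mono[OF b2 less_imp_le[OF K2(1)]]] by (simp add: mult.assoc)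
    ultimately show "\<exists>\<pi> c. \<pi> permutes {..<n} \<and> (\<forall>j<n. c j \<noteq> 0) \<and>
        \<nu> (mat n n (\<lambda>(i, j). Lam_r $$ (\<pi> i, \<pi> j)) - Lam_hat) \<le> K1 * (K * q) * \<epsilon> \<and>
        \<nu> (mat N n (\<lambda>(i, j). c j * V_r $$ (i, \<pi> j)) - V_N) \<le> K2 * (K * q) * \<epsilon>"
      using \<pi> c by blast
  qed
qed

end
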